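(* There exist constants $c,C>0$ such that for all integers $M,N\ge 2$, $$c\log\min\{M,N\}\le \alpha(M,N)\le C\log\min\{M,N\}.$$ In particular, $\alpha(M,N)\to\infty$ as $\min\{M,N\}$ tends to infinity. Here $$\alpha(M,N)=\inf\Big\{\|M\Delta b\|_{(M,N)}^2+\|N\Delta(\mathcal{F}_{(M,N)} b)\|_{(N,M)}^2\Big\},$$ where the infimum is taken over all $b\in\ell_2^{(M,N)}$ for which the Gabor system $G_{(M,N)}(b)$ is an orthonormal basis in $\ell_2^{(M,N)}$.
   Context: For $M,N\in\mathbb{N}$ put $d=MN$ and $\mathbb{Z}_d=\mathbb{Z}/d\mathbb{Z}$. $\ell_2^{(M,N)}$ is the space of all functions $b:\mathbb{Z}_d\to\mathbb{C}$ with norm $\|b\|_{(M,N)}^2=\frac1M\sum_{j=0}^{d-1}|b(j)|^2$ (and the corresponding inner product); thus $\ell_2^{(N,M)}$ has norm $\|b\|_{(N,M)}^2=\frac1N\sum_{j=0}^{d-1}|b(j)|^2$. The finite Fourier transform $\mathcal{F}_{(M,N)}b(k)=\frac1M\sum_{j=0}^{d-1}b(j)e^{-2\pi i jk/d}$ is unitary from $\ell_2^{(M,N)}$ to $\ell_2^{(N,M)}$. The discrete derivative is $\Delta b(j)=b(j+1)-b(j)$, $j\in\mathbb{Z}_d$ (indices modulo $d$). $M\mathbb{Z}_d$ denotes the set $\{Mk:k\in\mathbb{Z}\}$ modulo $d$, and $N\mathbb{Z}_d$ the set $\{Nk:k\in\mathbb{Z}\}$ modulo $d$. The Gabor system generated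 by $b\in\ell_2^{(M,N)}$ is $$G_{(M,N)}(b)=\{e^{2\pi i \ell j/d}\,b(j-k)\}_{(k,\ell)\in M\mathbb{Z}_d\times N\mathbb{Z}_d},$$ where each element is viewed as a function of $j\in\mathbb{Z}_d$. *)

theory Defs
  imports "HOL-Analysis.Analysis"
begin

text \<open>
  Throughout, d = MN. A function on the cyclic group of integers modulo d is represented by the
  corresponding d-periodic function on the integers, so that shifts of the argument need no
  explicit reduction modulo d. Note that the spaces for (M,N) and (N,M) have the same elements but
  differently normalised inner products.
\<close>

definition l2_space :: "nat \<Rightarrow> nat \<Rightarrow> (int \<Rightarrow> complex) set" where
  "l2_space M N = {b. \<forall>j. b (j + int (M * N)) = b j}"

definition l2_inner :: "nat \<Rightarrow> nat \<Rightarrow> (int \<Rightarrow> complex) \<Rightarrow> (int \<Rightarrow> complex) \<Rightarrow> complex" where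
  "l2_inner M N a b = 1 / of_nat M * (\<Sum>j\<in>{0..<int (M * N)}. a j * cnj (b j))"

definition l2_norm :: "nat \<Rightarrow> nat \<Rightarrow> (int \<Rightarrow> complex) \<Rightarrow> real" where
  "l2_norm M N b = sqrt (1 / real M * (\<Sum>j\<in>{0..<int (M * N)}. (cmod (b j))\<^sup>2))"

definition fin_fourier :: "nat \<Rightarrow> nat \<Rightarrow> (int \<Rightarrow> complex) \<Rightarrow> int \<Rightarrow> complex" where
  "fin_fourier M N b k =
     1 / of_nat M *
     (\<Sum>j\<in>{0..<int (M * N)}. b j * exp (- (2 * of_real pi * \<i> * of_int (j * k) / of_nat (M * N))))"

definition discrete_deriv :: "(int \<Rightarrow> complex) \<Rightarrow> int \<Rightarrow> complex" where
  "discrete_deriv b j = b (j + 1) - b j"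

text \<open>The multiples of m modulo d, as a set of representatives in \<open>{0..<d}\<close>.\<close>

definition multiples_mod :: "nat \<Rightarrow> nat \<Rightarrow> int set" where
  "multiples_mod m d = range (\<lambda>k::int. (int m * k) mod int d)"

definition gabor_index :: "nat \<Rightarrow> nat \<Rightarrow> (int \<times> int) set" where
  "gabor_index M N = multiples_mod M (M * N) \<times> multiples_mod N (M * N)"

definition gabor_system ::
    "nat \<Rightarrow> nat \<Rightarrow> (int \<Rightarrow> complex) \<Rightarrow> int \<times> int \<Rightarrow> int \<Rightarrow> complex" where
  "gabor_system M N b = (\<lambda>(k, l) j.
     exp (2 * of_real pi * \<i> * of_int (l * j) / of_nat (M * N)) * b (j - k))"

definition orthonormal_basis ::
    "nat \<Rightarrow> nat \<Rightarrow> 'i set \<Rightarrow> ('i \<Rightarrow> int \<Rightarrow> complex) \<Rightarrow> bool" where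
  "orthonormal_basis M N I e \<longleftrightarrow>
     (\<forall>i\<in>I. e i \<in> l2_space M N) \<and>
     (\<forall>i\<in>I. \<forall>i'\<in>I. l2_inner M N (e i) (e i') = (if i = i' then 1 else 0)) \<and>
     (\<forall>f\<in>l2_space M N. \<exists>c. \<forall>j. f j = (\<Sum>i\<in>I. c i * e i j))"

text \<open>
  For M, N \<open>\<ge>\<close> 1 the infimum is over a nonempty set of nonnegative reals (the indicator function of
  \<open>{0..<M}\<close>, extended periodically, generates an orthonormal basis), so it is a genuine real
  infimum.
\<close>

definition bl_alpha :: "nat \<Rightarrow> nat \<Rightarrow> real" where
  "bl_alpha M N =
     (INF b \<in> {b \<in> l2_space M N. orthonormal_basis M N (gabor_index M N) (gabor_system M N b)}.
        (l2_norm M N (\<lambda>j. of_nat M * discrete_deriv b j))\<^sup>2 +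
        (l2_norm N M (\<lambda>j. of_nat N * discrete_deriv (fin_fourier M N b) j))\<^sup>2)"

end

theory Submission
  imports Defs
begin

text \<open>
  The Zak transform \<open>Z\<close> turns generators of Gabor orthonormal bases into unimodular sections
  \<open>Z (m + M) n = e(n / N) Z m n\<close>, \<open>Z m (n + N) = Z m n\<close>, where \<open>e(x) = exp (2 \<pi> i x)\<close>, and, by
  Parseval, the functional to be minimised into a Dirichlet energy for a discrete connection of total
  flux \<open>2 \<pi>\<close>.

  For the lower bound, consider steps \<open>K\<close> and \<open>L\<close> in the two variables. Since the total flux is
  nonzero, at least a constant times \<open>K L\<close> of the plaquettes of size \<open>K \<times> L\<close> carry a vortex, so
  that \<open>Z\<close> jumps by at least 1 across one of their sides. As \<open>Z\<close> is unimodular, a large jump forces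
  a large second difference, and by the parallelogram law the squared second differences of step \<open>K\<close>
  add up to \<open>4 a(K) - a(2 K)\<close>, where \<open>a(K)\<close> is the sum of the squared first differences. Divided by
  \<open>4^s\<close>, these telescope over the steps \<open>2^s K\<close>, and each of the roughly \<open>log (min M N)\<close> dyadic
  scales contributes a fixed amount to the energy.

  For the upper bound, one vortex in the unit square with phase gradient bounded by the inverse
  distance to the vortex has energy \<open>O(1 + log (min M N))\<close>.
\<close>

section \<open>Discrete Fourier analysis\<close>

definition unit_char :: "real \<Rightarrow> complex" where
  "unit_char x = cis (2 * pi * x)"

lemma unit_char_add: "unit_char (x + y) = unit_char x * unit_char y"
  by (simp add: unit_char_def cis_mult distrib_left)

lemma unit_char_0 [simp]: "unit_char 0 = 1"
  by (simp add: unit_char_def)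

lemma norm_unit_char [simp]: "cmod (unit_char x) = 1"
  by (simp add: unit_char_def)

lemma unit_char_neq_0 [simp]: "unit_char x \<noteq> 0"
  by (simp add: unit_char_def)

lemma cnj_unit_char: "cnj (unit_char x) = unit_char (- x)"
  by (simp add: unit_char_def cis_cnj)

lemma unit_char_eq_1_iff: "unit_char x = 1 \<longleftrightarrow> x \<in> \<int>"
proof -
  have "unit_char x = exp (\<i> * of_real (2 * pi * x))"
    by (simp add: unit_char_def cis_conv_exp)
  also have "\<dots> = 1 \<longleftrightarrow> (\<exists>n::int. 2 * pi * x = of_int (2 * n) * pi)"
    by (subst exp_eq_1) simp
  also have "\<dots> \<longleftrightarrow> (\<exists>n::int. x = of_int n)"
    by (simp add: field_simps)
  finally show ?thesis by (auto elim: Ints_cases)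
qed

lemma unit_char_Ints: "x \<in> \<int> \<Longrightarrow> unit_char x = 1"
  by (simp add: unit_char_eq_1_iff)

lemma unit_char_add_Ints: "y \<in> \<int> \<Longrightarrow> unit_char (x + y) = unit_char x"
  by (simp add: unit_char_add unit_char_Ints)

lemma norm_unit_char_diff_le: "cmod (unit_char x - unit_char y) \<le> 2 * pi * \<bar>x - y\<bar>"
proof -
  have "unit_char x - unit_char y = unit_char y * (unit_char (x - y) - 1)"
    using unit_char_add[of y "x - y"] by (simp add: algebra_simps)
  hence "cmod (unit_char x - unit_char y) = cmod (exp (\<i> * of_real (2 * pi * (x - y))) - 1)"
    by (simp add: norm_mult unit_char_def cis_conv_exp)
  also have "\<dots> = 2 * \<bar>sin (2 * pi * (x - y) / 2)\<bar>"
    by (rule dist_exp_i_1)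
  also have "\<dots> \<le> 2 * \<bar>2 * pi * (x - y) / 2\<bar>"
    using abs_sin_x_le_abs_x by (intro mult_left_mono) auto
  finally show ?thesis by (simp add: abs_mult)
qed

lemma exp_eq_unit_char: "exp (2 * of_real pi * \<i> * of_int k / of_nat n) = unit_char (of_int k / of_nat n)"
  by (simp add: unit_char_def cis_conv_exp mult_ac)

lemma periodic_add_mult:
  fixes f :: "int \<Rightarrow> 'a"
  assumes "\<And>x. f (x + p) = f x"
  shows "f (x + p * k) = f x"
proof (induction k rule: int_induct[of _ 0])
  case (step1 i)
  then show ?case using assms[of "x + p * i"] by (simp add: algebra_simps)
next
  case (step2 i)
  then show ?case using assms[of "x + p * (i - 1)"] by (simp add: algebra_simps)
qed auto

lemma periodic_mod:
  fixes f :: "int \<Rightarrow> 'a"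
  assumes "\<And>x. f (x + p) = f x"
  shows "f (x mod p) = f x"
  using periodic_add_mult[of f p, OF assms, of "x mod p" "x div p"] by simp

lemma sum_periodic_shift:
  fixes f :: "int \<Rightarrow> 'a::comm_monoid_add"
  assumes "\<And>x. f (x + int p) = f x" "p > 0"
  shows "(\<Sum>x\<in>{0..<int p}. f (x + t)) = (\<Sum>x\<in>{0..<int p}. f x)"
  by (rule sum.reindex_bij_witness[of _ "\<lambda>x. (x - t) mod int p" "\<lambda>x. (x + t) mod int p"])
     (use assms periodic_mod[of f "int p"] in \<open>auto simp: mod_simps\<close>)

lemma sum_periodic_reflect:
  fixes f :: "int \<Rightarrow> 'a::comm_monoid_add"
  assumes "\<And>x. f (x + int p) = f x" "p > 0"
  shows "(\<Sum>x\<in>{0..<int p}. f (t - x)) = (\<Sum>x\<in>{0..<int p}. f x)"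
  by (rule sum.reindex_bij_witness[of _ "\<lambda>x. (t - x) mod int p" "\<lambda>x. (t - x) mod int p"])
     (use assms periodic_mod[of f "int p"] in \<open>auto simp: mod_simps\<close>)

lemma sum_blocks:
  fixes f :: "int \<Rightarrow> 'a::comm_monoid_add"
  assumes "M > 0"
  shows "(\<Sum>j\<in>{0..<int (M * N)}. f j) =
         (\<Sum>m\<in>{0..<int M}. \<Sum>k\<in>{0..<int N}. f (m + int M * k))"
proof -
  have lt: "m + int M * k < int (M * N)" if "m < int M" "k < int N" for m k
  proof -
    have "int M * k \<le> int M * (int N - 1)"
      using that by (intro mult_left_mono) auto
    thus ?thesis using that by (simp add: algebra_simps)
  qed
  have div_lt: "j div int M < int N" if "j < int (M * N)" for j
  proof (rule ccontr)
    assume "\<not> j div int M < int N"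
    hence "int M * int N \<le> int M * (j div int M)"
      by (intro mult_left_mono) auto
    also have "\<dots> \<le> j" using assms by (simp add: minus_mod_eq_mult_div[symmetric])
    finally show False using that by simp
  qed
  show ?thesis
    unfolding sum.cartesian_product
    by (rule sum.reindex_bij_witness[of _ "\<lambda>(m, k). m + int M * k" "\<lambda>j. (j mod int M, j div int M)"])
       (use assms lt div_lt in \<open>auto simp: pos_imp_zdiv_nonneg_iff simp del: of_nat_mult\<close>)
qed

text \<open>If \<open>N\<close> does not divide \<open>n\<close>, shifting the summation variable by
  one multiplies the sum by \<open>unit_char (n / N)\<close>, which is not 1, so the sum
  vanishes.\<close>

lemma sum_roots_of_unity:
  assumes "N > 0"
  shows "(\<Sum>k\<in>{0..<int N}. unit_char (of_int (k * n) / real N)) =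
         (if int N dvd n then of_nat N else 0)"
proof (cases "int N dvd n")
  case True
  then obtain q where "n = int N * q" by blast
  hence "unit_char (of_int (k * n) / real N) = 1" for k
    using assms by (intro unit_char_Ints) auto
  thus ?thesis using True by simp
next
  case False
  define S where "S = (\<Sum>k\<in>{0..<int N}. unit_char (of_int (k * n) / real N))"
  have "unit_char (of_int n / real N) * S = (\<Sum>k\<in>{0..<int N}. unit_char (of_int ((k + 1) * n) / real N))"
    by (simp add: S_def sum_distrib_left unit_char_add[symmetric] field_simps)
  also have "\<dots> = S"
    unfolding S_def
  proof (rule sum_periodic_shift)
    fix x
    show "unit_char (of_int ((x + int N) * n) / real N) = unit_char (of_int (x * n) / real N)"
      using unit_char_add_Ints[of "of_int n" "of_int (x * n) / real N"] assms by (simp add: field_simps)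
  qed fact
  finally have "S = 0 \<or> unit_char (of_int n / real N) = 1" by auto
  moreover have "of_int n / real N \<notin> \<int>"
  proof
    assume "of_int n / real N \<in> \<int>"
    then obtain q where "of_int n / real N = real_of_int q" by (auto elim: Ints_cases)
    hence "real_of_int n = real_of_int (int N * q)" using assms by (simp add: field_simps)
    hence "n = int N * q" by linarith
    thus False using False by simp
  qed
  ultimately show ?thesis using False by (simp add: unit_char_eq_1_iff S_def)
qed

text \<open>The sign \<open>s\<close> lets one lemma serve both orientations: \<open>s = 1\<close>
  recovers autocorrelations from their transforms, \<open>s = -1\<close> recovers a prescribed Zak
  transform in \<open>zak_surj\<close>.\<close>

lemma dft_inversion:
  assumes "N > 0" "r \<in> {0..<int N}" "s \<in> {1, -1}"
  shows "(\<Sum>n\<in>{0..<int N}. (\<Sum>k\<in>{0..<int N}. f k * unit_char (of_int (- s * k * n) / real N)) *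
            unit_char (of_int (s * r * n) / real N)) = of_nat N * f r"
proof -
  have "(\<Sum>n\<in>{0..<int N}. (\<Sum>k\<in>{0..<int N}. f k * unit_char (of_int (- s * k * n) / real N)) *
            unit_char (of_int (s * r * n) / real N)) =
        (\<Sum>n\<in>{0..<int N}. \<Sum>k\<in>{0..<int N}. f k * unit_char (of_int (n * (s * (r - k))) / real N))"
    unfolding sum_distrib_right mult.assoc unit_char_add[symmetric]
    by (simp add: algebra_simps add_divide_distrib diff_divide_distrib)
  also have "\<dots> = (\<Sum>k\<in>{0..<int N}. f k * (\<Sum>n\<in>{0..<int N}. unit_char (of_int (n * (s * (r - k))) / real N)))"
    by (subst sum.swap) (simp add: sum_distrib_left)
  also have "\<dots> = (\<Sum>k\<in>{0..<int N}. if k = r then of_nat N * f k else 0)"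
  proof (rule sum.cong)
    fix k assume k: "k \<in> {0..<int N}"
    have "int N dvd s * (r - k) \<longleftrightarrow> k = r"
    proof
      assume "int N dvd s * (r - k)"
      hence "int N dvd r - k" using assms(3) by (auto simp: dvd_diff_commute)
      thus "k = r" using k assms(2) zdvd_imp_le[of "int N" "r - k"] zdvd_imp_le[of "int N" "k - r"]
        by (cases "k < r"; cases "k > r") (auto simp: dvd_diff_commute)
    qed auto
    thus "f k * (\<Sum>n\<in>{0..<int N}. unit_char (of_int (n * (s * (r - k))) / real N)) =
          (if k = r then of_nat N * f k else 0)"
      using sum_roots_of_unity[OF assms(1), of "s * (r - k)"] by simp
  qed auto
  also have "\<dots> = of_nat N * f r"
    using assms(2) by simp
  finally show ?thesis .
qed

text \<open>Expanding only the conjugate factor of \<open>F n * cnj (F n)\<close> leaves inner sums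
  to which inversion applies.\<close>

lemma dft_parseval:
  assumes "N > 0"
  shows "(\<Sum>n\<in>{0..<int N}. (cmod (\<Sum>k\<in>{0..<int N}. f k * unit_char (of_int (- k * n) / real N)))\<^sup>2) =
         real N * (\<Sum>k\<in>{0..<int N}. (cmod (f k))\<^sup>2)"
proof -
  define F where "F = (\<lambda>n. \<Sum>k\<in>{0..<int N}. f k * unit_char (of_int (- k * n) / real N))"
  have "complex_of_real (\<Sum>n\<in>{0..<int N}. (cmod (F n))\<^sup>2) = (\<Sum>n\<in>{0..<int N}. F n * cnj (F n))"
    by (simp add: complex_norm_square del: of_real_power)
  also have "\<dots> = (\<Sum>n\<in>{0..<int N}. \<Sum>k\<in>{0..<int N}. cnj (f k) * (F n * unit_char (of_int (k * n) / real N)))"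
    by (intro sum.cong) (auto simp: F_def cnj_unit_char sum_distrib_left mult_ac)
  also have "\<dots> = (\<Sum>k\<in>{0..<int N}. cnj (f k) * (\<Sum>n\<in>{0..<int N}. F n * unit_char (of_int (k * n) / real N)))"
    by (subst sum.swap) (simp add: sum_distrib_left)
  also have "\<dots> = (\<Sum>k\<in>{0..<int N}. cnj (f k) * (of_nat N * f k))"
    using dft_inversion[OF assms, of _ 1 f] by (intro sum.cong) (auto simp: F_def)
  also have "\<dots> = complex_of_real (real N * (\<Sum>k\<in>{0..<int N}. (cmod (f k))\<^sup>2))"
    by (simp add: complex_norm_square sum_distrib_left mult_ac del: of_real_power)
  finally show ?thesis
    unfolding F_def of_real_eq_iff .
qed

section \<open>The Zak transform and Gabor bases\<close>

text \<open>For fixed \<open>m\<close> this is the discrete Fourier transform of \<open>b\<close>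
  along the residue class of \<open>m\<close> modulo \<open>M\<close>. Both arguments run over all
  integers, so that the twist appears as quasi-periodicity instead of a boundary condition.\<close>

definition zak :: "nat \<Rightarrow> nat \<Rightarrow> (int \<Rightarrow> complex) \<Rightarrow> int \<Rightarrow> int \<Rightarrow> complex" where
  "zak M N b m n = (\<Sum>k\<in>{0..<int N}. b (m + int M * k) * unit_char (of_int (- k * n) / real N))"

lemma l2_space_periodic: "b \<in> l2_space M N \<Longrightarrow> b (j + int M * int N) = b j"
  by (simp add: l2_space_def)

lemma zak_quasi_periodic:
  assumes "b \<in> l2_space M N" "N > 0"
  shows "zak M N b (m + int M) n = unit_char (of_int n / real N) * zak M N b m n"
proof -
  define f where "f = (\<lambda>k. b (m + int M * k) * unit_char (of_int (- k * n) / real N))"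
  have "zak M N b (m + int M) n = (\<Sum>k\<in>{0..<int N}. unit_char (of_int n / real N) * f (k + 1))"
    unfolding zak_def f_def
  proof (rule sum.cong)
    fix k
    have "unit_char (of_int (- k * n) / real N) =
          unit_char (of_int n / real N) * unit_char (of_int (- (k + 1) * n) / real N)"
      unfolding unit_char_add[symmetric]
      by (simp add: algebra_simps add_divide_distrib diff_divide_distrib)
    thus "b (m + int M + int M * k) * unit_char (of_int (- k * n) / real N) =
          unit_char (of_int n / real N) *
            (b (m + int M * (k + 1)) * unit_char (of_int (- (k + 1) * n) / real N))"
      by (simp add: algebra_simps)
  qed auto
  also have "\<dots> = unit_char (of_int n / real N) * (\<Sum>k\<in>{0..<int N}. f (k + 1))"
    by (simp add: sum_distrib_left)
  also have "(\<Sum>k\<in>{0..<int N}. f (k + 1)) = (\<Sum>k\<in>{0..<int N}. f k)"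
  proof (rule sum_periodic_shift)
    fix k
    have "of_int (- (k + int N) * n) / real N = of_int (- k * n) / real N + of_int (- n)"
      using assms(2) by (simp add: field_simps)
    hence "unit_char (of_int (- (k + int N) * n) / real N) = unit_char (of_int (- k * n) / real N)"
      by (simp only: unit_char_add_Ints Ints_of_int)
    moreover have "b (m + int M * (k + int N)) = b (m + int M * k)"
      using l2_space_periodic[OF assms(1), of "m + int M * k"] by (simp add: algebra_simps)
    ultimately show "f (k + int N) = f k"
      by (simp only: f_def)
  qed fact
  finally show ?thesis by (simp add: zak_def f_def)
qed

lemma zak_periodic:
  assumes "N > 0"
  shows "zak M N b m (n + int N) = zak M N b m n"
  unfolding zak_def
proof (rule sum.cong)
  fix k
  have "of_int (- k * (n + int N)) / real N = of_int (- k * n) / real N + of_int (- k)"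
    using assms by (simp add: field_simps)
  thus "b (m + int M * k) * unit_char (of_int (- k * (n + int N)) / real N) =
        b (m + int M * k) * unit_char (of_int (- k * n) / real N)"
    by (simp only: unit_char_add_Ints Ints_of_int)
qed auto

lemma zak_diff: "zak M N (\<lambda>j. f j - g j) m n = zak M N f m n - zak M N g m n"
  by (simp add: zak_def left_diff_distrib sum_subtractf)

lemma zak_translate: "zak M N (\<lambda>j. b (j + t)) m n = zak M N b (m + t) n"
  by (simp add: zak_def add_ac)

text \<open>Modulating \<open>b\<close> becomes, up to a unit factor, a unit shift in
  \<open>n\<close>. Since shifting the Fourier transform amounts to modulating \<open>b\<close>, the
  second energy term thereby becomes a difference in \<open>n\<close>.\<close>

lemma zak_modulate:
  assumes "M > 0"
  shows "zak M N (\<lambda>j. unit_char (of_int j / real (M * N)) * b j) m n =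
         unit_char (of_int m / real (M * N)) * zak M N b m (n - 1)"
  unfolding zak_def sum_distrib_left
proof (rule sum.cong)
  fix k
  have "unit_char (of_int (m + int M * k) / real (M * N)) * unit_char (of_int (- k * n) / real N) =
        unit_char (of_int m / real (M * N)) * unit_char (of_int (- k * (n - 1)) / real N)"
    unfolding unit_char_add[symmetric] using assms
    by (intro arg_cong[of _ _ unit_char]) (cases "N = 0"; simp add: field_simps)
  thus "unit_char (of_int (m + int M * k) / real (M * N)) * b (m + int M * k) *
          unit_char (of_int (- k * n) / real N) =
        unit_char (of_int m / real (M * N)) *
          (b (m + int M * k) * unit_char (of_int (- k * (n - 1)) / real N))"
    by (simp add: algebra_simps)
qed auto

lemma zak_parseval:
  assumes "M > 0" "N > 0"
  shows "(\<Sum>j\<in>{0..<int (M * N)}. (cmod (f j))\<^sup>2) =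
         (\<Sum>m\<in>{0..<int M}. \<Sum>n\<in>{0..<int N}. (cmod (zak M N f m n))\<^sup>2) / real N"
proof -
  have "(\<Sum>n\<in>{0..<int N}. (cmod (zak M N f m n))\<^sup>2) =
        real N * (\<Sum>k\<in>{0..<int N}. (cmod (f (m + int M * k)))\<^sup>2)" for m
    unfolding zak_def by (rule dft_parseval) fact
  thus ?thesis using assms
    by (simp add: sum_blocks sum_distrib_left[symmetric] del: of_nat_mult)
qed

section \<open>The energy in Zak coordinates\<close>

definition bl_energy :: "nat \<Rightarrow> nat \<Rightarrow> (int \<Rightarrow> complex) \<Rightarrow> real" where
  "bl_energy M N b = (l2_norm M N (\<lambda>j. of_nat M * discrete_deriv b j))\<^sup>2 +
        (l2_norm N M (\<lambda>j. of_nat N * discrete_deriv (fin_fourier M N b) j))\<^sup>2"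

text \<open>Differencing in frequency multiplies \<open>b j\<close> by
  \<open>unit_char (- j / d) - 1\<close>; Parseval on the group of order \<open>d\<close> does the
  rest. The result uses the conjugate factor, which has the same modulus, to match
  \<open>zak_modulate\<close>.\<close>

lemma norm_fourier_deriv:
  assumes "M > 0" "N > 0"
  shows "(l2_norm N M (\<lambda>j. of_nat N * discrete_deriv (fin_fourier M N b) j))\<^sup>2 =
     real N ^ 2 / real M *
       (\<Sum>j\<in>{0..<int (M * N)}. (cmod (unit_char (of_int j / real (M * N)) * b j - b j))\<^sup>2)"
proof -
  define d where "d = M * N"
  define g where "g = (\<lambda>j. b j * (unit_char (- of_int j / real d) - 1))"
  have d: "d > 0" using assms by (simp add: d_def)
  have "fin_fourier M N b k =
          1 / of_nat M * (\<Sum>j\<in>{0..<int d}. b j * unit_char (of_int (- j * k) / real d))" for k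
    using exp_eq_unit_char[of "- j * k" d for j]
    by (simp add: fin_fourier_def d_def[symmetric] del: of_nat_mult)
  moreover have "unit_char (of_int (- j * (k + 1)) / real d) =
                 unit_char (- of_int j / real d) * unit_char (of_int (- j * k) / real d)" for j k
    unfolding unit_char_add[symmetric]
    by (simp add: algebra_simps add_divide_distrib diff_divide_distrib)
  hence "b j * unit_char (of_int (- j * (k + 1)) / real d) - b j * unit_char (of_int (- j * k) / real d) =
         g j * unit_char (of_int (- j * k) / real d)" for j k
    by (simp only: g_def) (simp add: ring_distribs)
  ultimately have deriv: "discrete_deriv (fin_fourier M N b) k =
          1 / of_nat M * (\<Sum>j\<in>{0..<int d}. g j * unit_char (of_int (- j * k) / real d))" for k
    unfolding discrete_deriv_def by (simp only: right_diff_distrib[symmetric] sum_subtractf[symmetric])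
  have norm_g: "cmod (g j) = cmod (unit_char (of_int j / real d) * b j - b j)" for j
  proof -
    have "unit_char (of_int j / real d) * b j - b j = - (unit_char (of_int j / real d) * g j)"
      using unit_char_add[of "of_int j / real d" "- of_int j / real d"]
      by (simp add: g_def algebra_simps)
    thus ?thesis by (simp add: norm_mult)
  qed
  have "(l2_norm N M (\<lambda>j. of_nat N * discrete_deriv (fin_fourier M N b) j))\<^sup>2 =
        1 / real N * (\<Sum>k\<in>{0..<int d}. (real N / real M)\<^sup>2 *
          (cmod (\<Sum>j\<in>{0..<int d}. g j * unit_char (of_int (- j * k) / real d)))\<^sup>2)"
    unfolding l2_norm_def deriv
    by (simp add: real_sqrt_pow2 sum_nonneg norm_mult norm_divide power_mult_distrib power_divide
        mult.commute[of N M] d_def[symmetric] del: of_nat_mult)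
  also have "\<dots> = 1 / real N * (real N / real M)\<^sup>2 *
                    (real d * (\<Sum>j\<in>{0..<int d}. (cmod (g j))\<^sup>2))"
    unfolding sum_distrib_left[symmetric] dft_parseval[OF d] by simp
  also have "1 / real N * (real N / real M)\<^sup>2 * (real d * S) = real N ^ 2 / real M * S" for S
    using assms by (simp add: d_def power2_eq_square)
  finally show ?thesis unfolding norm_g d_def .
qed

text \<open>The factor \<open>unit_char (m / (M * N))\<close> is the parallel transport of the
  connection; its dependence on \<open>m\<close> is the source of the flux.\<close>

lemma bl_energy_zak:
  assumes "M > 0" "N > 0"
  shows "bl_energy M N b =
     real M / real N * (\<Sum>m\<in>{0..<int M}. \<Sum>n\<in>{0..<int N}.
        (cmod (zak M N b (m + 1) n - zak M N b m n))\<^sup>2) +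
     real N / real M * (\<Sum>m\<in>{0..<int M}. \<Sum>n\<in>{0..<int N}.
        (cmod (unit_char (of_int m / real (M * N)) * zak M N b m (n - 1) - zak M N b m n))\<^sup>2)"
proof -
  have "(l2_norm M N (\<lambda>j. of_nat M * discrete_deriv b j))\<^sup>2 =
        real M * (\<Sum>j\<in>{0..<int (M * N)}. (cmod (b (j + 1) - b j))\<^sup>2)"
  proof -
    have "(l2_norm M N (\<lambda>j. of_nat M * discrete_deriv b j))\<^sup>2 =
          1 / real M * (\<Sum>j\<in>{0..<int (M * N)}. (real M)\<^sup>2 * (cmod (b (j + 1) - b j))\<^sup>2)"
      by (simp add: l2_norm_def sum_nonneg discrete_deriv_def norm_mult power_mult_distrib del: of_nat_mult)
    also have "\<dots> = real M * (\<Sum>j\<in>{0..<int (M * N)}. (cmod (b (j + 1) - b j))\<^sup>2)"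
      unfolding sum_distrib_left[symmetric] using assms by (simp add: power2_eq_square)
    finally show ?thesis .
  qed
  thus ?thesis
    unfolding bl_energy_def norm_fourier_deriv[OF assms] zak_parseval[OF assms] zak_diff
      zak_translate zak_modulate[OF assms(1)]
    using assms by (simp add: power2_eq_square)
qed

section \<open>Orthonormality as unimodularity of the Zak transform\<close>

definition zak_corr :: "nat \<Rightarrow> nat \<Rightarrow> (int \<Rightarrow> complex) \<Rightarrow> int \<Rightarrow> int \<Rightarrow> complex" where
  "zak_corr M N b r m = (\<Sum>k\<in>{0..<int N}. b (m + int M * k) * cnj (b (m + int M * (k - r))))"

lemma zak_corr_periodic:
  assumes "b \<in> l2_space M N"
  shows "zak_corr M N b (r + int N) m = zak_corr M N b r m"
proof -
  have "b (m + int M * (k - (r + int N))) = b (m + int M * (k - r))" for k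
    using l2_space_periodic[OF assms, of "m + int M * (k - (r + int N))"]
    by (simp add: algebra_simps)
  thus ?thesis by (simp add: zak_corr_def)
qed

lemma zak_corr_shift:
  assumes "b \<in> l2_space M N" "N > 0"
  shows "zak_corr M N b r (m + int M * t) = zak_corr M N b r m"
proof -
  define f where "f = (\<lambda>k. b (m + int M * k) * cnj (b (m + int M * (k - r))))"
  have "(\<Sum>k\<in>{0..<int N}. f (k + t)) = (\<Sum>k\<in>{0..<int N}. f k)"
  proof (rule sum_periodic_shift)
    show "f (k + int N) = f k" for k
      using l2_space_periodic[OF assms(1), of "m + int M * k"]
            l2_space_periodic[OF assms(1), of "m + int M * (k - r)"]
      by (simp add: f_def algebra_simps)
  qed fact
  thus ?thesis by (simp add: zak_corr_def f_def algebra_simps)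
qed

text \<open>Wiener-Khinchin on each residue class: \<open>zak_corr\<close> is the cyclic
  autocorrelation of the samples \<open>b (m + M * k)\<close>, and its transform is their power
  spectrum.\<close>

lemma norm_zak_eq_dft_corr:
  assumes "b \<in> l2_space M N" "N > 0"
  shows "complex_of_real ((cmod (zak M N b m n))\<^sup>2) =
         (\<Sum>r\<in>{0..<int N}. zak_corr M N b r m * unit_char (of_int (- r * n) / real N))"
proof -
  have "complex_of_real ((cmod (zak M N b m n))\<^sup>2) = zak M N b m n * cnj (zak M N b m n)"
    by (rule complex_norm_square)
  also have "\<dots> = (\<Sum>k\<in>{0..<int N}. \<Sum>k'\<in>{0..<int N}.
                    b (m + int M * k) * cnj (b (m + int M * k')) *
                    unit_char (of_int (- (k - k') * n) / real N))"
    unfolding zak_def cnj_sum sum_product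
  proof (intro sum.cong)
    fix k k'
    have "unit_char (of_int (- k * n) / real N) * unit_char (- (of_int (- k' * n) / real N)) =
          unit_char (of_int (- (k - k') * n) / real N)"
      unfolding unit_char_add[symmetric] by (simp add: field_simps diff_divide_distrib)
    thus "b (m + int M * k) * unit_char (of_int (- k * n) / real N) *
            cnj (b (m + int M * k') * unit_char (of_int (- k' * n) / real N)) =
          b (m + int M * k) * cnj (b (m + int M * k')) *
            unit_char (of_int (- (k - k') * n) / real N)"
      by (simp add: cnj_unit_char mult_ac)
  qed auto
  also have "\<dots> = (\<Sum>k\<in>{0..<int N}. \<Sum>r\<in>{0..<int N}.
                    b (m + int M * k) * cnj (b (m + int M * (k - r))) *
                    unit_char (of_int (- r * n) / real N))"
  proof (rule sum.cong)
    fix k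
    \<comment> \<open>The substitution \<open>k' = k - r\<close> is a reflection over a full period
      of this summand.\<close>
    define f where "f = (\<lambda>k'. b (m + int M * k) * cnj (b (m + int M * k')) *
                    unit_char (of_int (- (k - k') * n) / real N))"
    have "(\<Sum>r\<in>{0..<int N}. f (k - r)) = (\<Sum>r\<in>{0..<int N}. f r)"
    proof (rule sum_periodic_reflect)
      fix k'
      have "unit_char (of_int (- (k - (k' + int N)) * n) / real N) =
            unit_char (of_int (- (k - k') * n) / real N)"
        using unit_char_add_Ints[of "of_int n" "of_int (- (k - k') * n) / real N"] assms(2)
        by (simp add: field_simps)
      thus "f (k' + int N) = f k'"
        using l2_space_periodic[OF assms(1), of "m + int M * k'"] by (simp add: f_def algebra_simps)
    qed fact
    thus "(\<Sum>k'\<in>{0..<int N}. b (m + int M * k) * cnj (b (m + int M * k')) *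
                    unit_char (of_int (- (k - k') * n) / real N)) =
          (\<Sum>r\<in>{0..<int N}. b (m + int M * k) * cnj (b (m + int M * (k - r))) *
                    unit_char (of_int (- r * n) / real N))"
      by (simp add: f_def)
  qed auto
  also have "\<dots> = (\<Sum>r\<in>{0..<int N}. zak_corr M N b r m * unit_char (of_int (- r * n) / real N))"
    by (subst sum.swap) (simp add: zak_corr_def sum_distrib_right)
  finally show ?thesis .
qed

lemma multiples_mod_eq:
  assumes "M > 0" "N > 0"
  shows "multiples_mod M (M * N) = (\<lambda>k. int M * k) ` {0..<int N}"
proof -
  have *: "(int M * k) mod int (M * N) = int M * (k mod int N)" for k
    unfolding of_nat_mult by (rule mod_mult_mult1)
  show ?thesis
    unfolding multiples_mod_def *
  proof (intro equalityI subsetI)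
    fix x assume "x \<in> (\<lambda>k. int M * k) ` {0..<int N}"
    then obtain k where k: "x = int M * k" "k \<in> {0..<int N}" by blast
    hence "x = int M * (k mod int N)" by simp
    thus "x \<in> range (\<lambda>k. int M * (k mod int N))" by blast
  qed (use assms in auto)
qed

lemma gabor_index_eq:
  assumes "M > 0" "N > 0"
  shows "gabor_index M N = (\<lambda>(k, l). (int M * k, int N * l)) ` ({0..<int N} \<times> {0..<int M})"
  unfolding gabor_index_def multiples_mod_eq[OF assms]
    multiples_mod_eq[OF assms(2,1), unfolded mult.commute[of N M]]
  by auto

lemma gabor_system_eq:
  assumes "N > 0"
  shows "gabor_system M N b (int M * k, int N * l) j =
         unit_char (of_int (l * j) / real M) * b (j - int M * k)"
proof -
  have "real_of_int (int N * l * j) / real (M * N) = of_int (l * j) / real M"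
    using assms by (simp add: field_simps)
  thus ?thesis
    by (simp add: gabor_system_def exp_eq_unit_char del: of_nat_mult of_int_mult)
qed

text \<open>In the coordinates \<open>j = m + M * i\<close>, modulation by a multiple of
  \<open>N\<close> depends only on \<open>m\<close>, so the sum over \<open>i\<close> is an
  autocorrelation at lag \<open>k' - k\<close>; the common translation by \<open>M * k\<close> drops
  out by \<open>zak_corr_shift\<close>.\<close>

lemma inner_gabor:
  assumes b: "b \<in> l2_space M N" and pos: "M > 0" "N > 0"
  shows "l2_inner M N (gabor_system M N b (int M * k, int N * l))
                      (gabor_system M N b (int M * k', int N * l')) =
         1 / of_nat M * (\<Sum>m\<in>{0..<int M}.
            unit_char (of_int (m * (l - l')) / real M) * zak_corr M N b (k' - k) m)"
proof -
  have "(\<Sum>i\<in>{0..<int N}. gabor_system M N b (int M * k, int N * l) (m + int M * i) *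
           cnj (gabor_system M N b (int M * k', int N * l') (m + int M * i))) =
        unit_char (of_int (m * (l - l')) / real M) * zak_corr M N b (k' - k) m" for m
  proof -
    have *: "unit_char (of_int (l * (m + int M * i)) / real M) *
               unit_char (- (of_int (l' * (m + int M * i)) / real M)) =
             unit_char (of_int (m * (l - l')) / real M)" for i
    proof -
      have "of_int (l * (m + int M * i)) / real M + - (of_int (l' * (m + int M * i)) / real M) =
            of_int (m * (l - l')) / real M + of_int (i * (l - l'))"
        using pos by (simp add: field_simps)
      thus ?thesis
        unfolding unit_char_add[symmetric] by (simp only: unit_char_add_Ints Ints_of_int)
    qed
    have "gabor_system M N b (int M * k, int N * l) (m + int M * i) *
           cnj (gabor_system M N b (int M * k', int N * l') (m + int M * i)) =
          unit_char (of_int (m * (l - l')) / real M) *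
           (b (m + int M * (-k) + int M * i) * cnj (b (m + int M * (- k) + int M * (i - (k' - k)))))" for i
      unfolding gabor_system_eq[OF pos(2)] *[of i, symmetric] complex_cnj_mult cnj_unit_char
      by (simp add: algebra_simps)
    hence "(\<Sum>i\<in>{0..<int N}. gabor_system M N b (int M * k, int N * l) (m + int M * i) *
             cnj (gabor_system M N b (int M * k', int N * l') (m + int M * i))) =
           unit_char (of_int (m * (l - l')) / real M) * zak_corr M N b (k' - k) (m + int M * (- k))"
      unfolding zak_corr_def by (simp only: sum_distrib_left)
    thus ?thesis unfolding zak_corr_shift[OF b pos(2)] .
  qed
  thus ?thesis
    unfolding l2_inner_def sum_blocks[OF pos(1)] by (simp only:)
qed

text \<open>The inner products with the element of index \<open>(0, 0)\<close> are, up to the factor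
  \<open>1 / M\<close>, the Fourier coefficients in \<open>m\<close> of the autocorrelation, so
  inversion determines it.\<close>

lemma zak_corr_of_orthonormal_basis:
  assumes b: "b \<in> l2_space M N" and pos: "M > 0" "N > 0"
    and onb: "orthonormal_basis M N (gabor_index M N) (gabor_system M N b)"
    and r: "r \<in> {0..<int N}" and m: "m \<in> {0..<int M}"
  shows "zak_corr M N b r m = (if r = 0 then 1 else 0)"
proof -
  have F: "(\<Sum>m\<in>{0..<int M}. zak_corr M N b r m * unit_char (of_int (- 1 * m * l) / real M)) =
           (if r = 0 \<and> l = 0 then of_nat M else 0)" if "l \<in> {0..<int M}" for l
  proof -
    have "(0, 0) \<in> {0..<int N} \<times> {0..<int M}" "(r, l) \<in> {0..<int N} \<times> {0..<int M}"
      using that r pos by auto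
    from this[THEN imageI[where f = "\<lambda>(k, l). (int M * k, int N * l)"]]
    have "(int M * 0, int N * 0) \<in> gabor_index M N" "(int M * r, int N * l) \<in> gabor_index M N"
      unfolding gabor_index_eq[OF pos] prod.case by blast+
    hence "l2_inner M N (gabor_system M N b (int M * 0, int N * 0))
                        (gabor_system M N b (int M * r, int N * l)) =
           (if r = 0 \<and> l = 0 then 1 else 0)"
      using onb pos unfolding orthonormal_basis_def by auto
    thus ?thesis
      unfolding inner_gabor[OF b pos] using pos by (auto simp: field_simps)
  qed
  have "of_nat M * zak_corr M N b r m = (\<Sum>l\<in>{0..<int M}.
          (\<Sum>m\<in>{0..<int M}. zak_corr M N b r m * unit_char (of_int (- 1 * m * l) / real M)) *
          unit_char (of_int (1 * m * l) / real M))"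
    by (rule dft_inversion[OF pos(1) m, symmetric]) simp
  also have "\<dots> =
        (\<Sum>l\<in>{0..<int M}. (if r = 0 \<and> l = 0 then of_nat M else 0) * unit_char (of_int (1 * m * l) / real M))"
    by (intro sum.cong refl) (simp only: F)
  also have "\<dots> = (\<Sum>l\<in>{0..<int M}. if l = 0 then (if r = 0 then of_nat M else 0) else 0)"
    by (intro sum.cong) auto
  also have "\<dots> = of_nat M * (if r = 0 then 1 else 0)"
    using pos by simp
  finally show ?thesis using pos by (simp split: if_splits)
qed

text \<open>The autocorrelation is a unit impulse, whose power spectrum is constantly 1.
  Quasi-periodicity carries this from one period to all \<open>m\<close>.\<close>

lemma norm_zak_of_orthonormal_basis:
  assumes b: "b \<in> l2_space M N" and pos: "M > 0" "N > 0"
    and onb: "orthonormal_basis M N (gabor_index M N) (gabor_system M N b)"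
  shows "cmod (zak M N b m n) = 1"
proof -
  have *: "cmod (zak M N b m n) = 1" if "m \<in> {0..<int M}" for m
  proof -
    have "complex_of_real ((cmod (zak M N b m n))\<^sup>2) =
          (\<Sum>r\<in>{0..<int N}. if r = 0 then 1 else 0)"
      unfolding norm_zak_eq_dft_corr[OF b pos(2)]
      using zak_corr_of_orthonormal_basis[OF b pos onb _ that] by (intro sum.cong) auto
    also have "\<dots> = complex_of_real 1" using pos by simp
    finally have "(cmod (zak M N b m n))\<^sup>2 = 1" unfolding of_real_eq_iff .
    thus ?thesis using norm_ge_zero[of "zak M N b m n"] by (auto simp: power2_eq_1_iff)
  qed
  have "cmod (zak M N b m n) = cmod (zak M N b (m mod int M) n)"
    by (rule periodic_mod[symmetric]) (simp add: zak_quasi_periodic[OF b pos(2)] norm_mult)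
  also have "\<dots> = 1" using * pos by simp
  finally show ?thesis .
qed

text \<open>A flat power spectrum inverts to an impulse. Divisibility replaces \<open>r = 0\<close>
  because later lags are differences, possibly negative.\<close>

lemma zak_corr_of_norm_zak:
  assumes b: "b \<in> l2_space M N" and pos: "M > 0" "N > 0"
    and norm: "\<And>m n. cmod (zak M N b m n) = 1"
  shows "zak_corr M N b r m = (if int N dvd r then 1 else 0)"
proof -
  have *: "zak_corr M N b r m = (if r = 0 then 1 else 0)" if r: "r \<in> {0..<int N}" for r
  proof -
    have "of_nat N * zak_corr M N b r m =
          (\<Sum>n\<in>{0..<int N}. complex_of_real ((cmod (zak M N b m n))\<^sup>2) *
              unit_char (of_int (1 * r * n) / real N))"
      unfolding norm_zak_eq_dft_corr[OF b pos(2)]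
      by (subst dft_inversion[OF pos(2) r, of 1, symmetric]) auto
    also have "\<dots> = (\<Sum>n\<in>{0..<int N}. unit_char (of_int (n * r) / real N))"
      unfolding norm by (simp add: mult.commute)
    also have "\<dots> = (if int N dvd r then of_nat N else 0)"
      by (rule sum_roots_of_unity) fact
    also have "int N dvd r \<longleftrightarrow> r = 0"
      using r by (auto dest: zdvd_imp_le)
    finally show ?thesis using pos by (simp split: if_splits)
  qed
  have "zak_corr M N b r m = zak_corr M N b (r mod int N) m"
    by (rule periodic_mod[symmetric]) (rule zak_corr_periodic[OF b])
  also have "\<dots> = (if int N dvd r then 1 else 0)"
    using * pos by (simp add: dvd_eq_mod_eq_0)
  finally show ?thesis .
qed

lemma gabor_system_in_l2_space:
  assumes b: "b \<in> l2_space M N" and pos: "M > 0" "N > 0"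
  shows "gabor_system M N b (int M * k, int N * l) \<in> l2_space M N"
  unfolding l2_space_def gabor_system_eq[OF pos(2)]
proof (intro CollectI allI)
  fix j
  have "of_int (l * (j + int (M * N))) / real M = of_int (l * j) / real M + of_int (l * int N)"
    using pos by (simp add: field_simps)
  hence "unit_char (of_int (l * (j + int (M * N))) / real M) = unit_char (of_int (l * j) / real M)"
    by (simp only: unit_char_add_Ints Ints_of_int)
  moreover have "b (j + int (M * N) - int M * k) = b (j - int M * k)"
    using l2_space_periodic[OF b, of "j - int M * k"] by (simp add: algebra_simps)
  ultimately show "unit_char (of_int (l * (j + int (M * N))) / real M) * b (j + int (M * N) - int M * k) =
            unit_char (of_int (l * j) / real M) * b (j - int M * k)" by simp
qed

text \<open>Completeness by direct calculation: summing over modulations forces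
  \<open>i = j + M * r\<close> modulo \<open>d\<close>, and summing over translations then produces
  the autocorrelation at lag \<open>- r\<close>, which leaves only \<open>r = 0\<close>.\<close>

lemma gabor_expansion:
  assumes b: "b \<in> l2_space M N" and f: "f \<in> l2_space M N" and pos: "M > 0" "N > 0"
    and norm: "\<And>m n. cmod (zak M N b m n) = 1"
  shows "f j = (\<Sum>i\<in>gabor_index M N. l2_inner M N f (gabor_system M N b i) * gabor_system M N b i j)"
proof -
  define d where "d = M * N"
  define G where "G = (\<lambda>k i. f i * cnj (b (i - int M * k)) * b (j - int M * k))"
  have per_f: "f (i + int d) = f i" and per_b: "b (i + int d) = b i" for i
    using l2_space_periodic[OF f] l2_space_periodic[OF b] by (auto simp: d_def)
  have per_G: "G k (i + int d) = G k i" for k i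
    using per_f[of i] per_b[of "i - int M * k"] by (simp add: G_def algebra_simps)
  have chars: "(\<Sum>l\<in>{0..<int M}. unit_char (of_int (l * (j - i)) / real M)) =
               (if int M dvd j - i then of_nat M else 0)" for i
    by (rule sum_roots_of_unity) fact
  have residue: "(\<Sum>i\<in>{0..<int d}. if int M dvd j - i then G k i else 0) =
                 (\<Sum>r\<in>{0..<int N}. G k (j + int M * r))" for k
  proof -
    define H where "H = (\<lambda>i. if int M dvd j - i then G k i else 0)"
    have "H (i + int d) = H i" for i
    proof -
      have "j - (i + int d) = (j - i) - int M * int N" by (simp add: d_def)
      thus ?thesis unfolding H_def per_G by (metis dvd_diff_left_iff dvd_triv_left)
    qed
    \<comment> \<open>Recentring at \<open>j\<close> puts the residue class of \<open>j\<close> into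
      the block \<open>m = 0\<close>.\<close>
    hence "(\<Sum>i\<in>{0..<int d}. H i) = (\<Sum>i\<in>{0..<int d}. H (i + j))"
      using pos by (intro sum_periodic_shift[symmetric]) (auto simp: d_def)
    also have "\<dots> = (\<Sum>m\<in>{0..<int M}. \<Sum>r\<in>{0..<int N}. H (m + int M * r + j))"
      unfolding d_def by (rule sum_blocks) fact
    also have "\<dots> = (\<Sum>m\<in>{0..<int M}. if m = 0 then \<Sum>r\<in>{0..<int N}. G k (j + int M * r) else 0)"
    proof (intro sum.cong refl)
      fix m assume m: "m \<in> {0..<int M}"
      have "int M dvd j - (m + int M * r + j) \<longleftrightarrow> m = 0" for r
      proof -
        have "j - (m + int M * r + j) = - (m + int M * r)" by simp
        hence "int M dvd j - (m + int M * r + j) \<longleftrightarrow> int M dvd m"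
          by (simp only: dvd_minus_iff) (metis dvd_add_left_iff dvd_triv_left)
        also have "\<dots> \<longleftrightarrow> m = 0" using m by (auto dest: zdvd_imp_le)
        finally show ?thesis .
      qed
      thus "(\<Sum>r\<in>{0..<int N}. H (m + int M * r + j)) =
            (if m = 0 then \<Sum>r\<in>{0..<int N}. G k (j + int M * r) else 0)"
        by (simp add: H_def add_ac)
    qed
    also have "\<dots> = (\<Sum>r\<in>{0..<int N}. G k (j + int M * r))" using pos by simp
    finally show ?thesis by (simp add: H_def)
  qed
  \<comment> \<open>Replacing \<open>k\<close> by \<open>- k\<close> brings the translates into
    autocorrelation form.\<close>
  have corr: "(\<Sum>k\<in>{0..<int N}. G k (j + int M * r)) = (if r = 0 then f j else 0)"
    if r: "r \<in> {0..<int N}" for r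
  proof -
    define h where "h = (\<lambda>k. f (j + int M * r) * (b (j + int M * k) * cnj (b (j + int M * (k - (- r))))))"
    have "(\<Sum>k\<in>{0..<int N}. h (0 - k)) = (\<Sum>k\<in>{0..<int N}. h k)"
    proof (rule sum_periodic_reflect)
      show "h (k + int N) = h k" for k
        using per_b[of "j + int M * k"] per_b[of "j + int M * (k - (- r))"]
        by (simp add: h_def d_def algebra_simps)
    qed fact
    also have "\<dots> = f (j + int M * r) * zak_corr M N b (- r) j"
      by (simp add: h_def zak_corr_def sum_distrib_left)
    also have "\<dots> = (if r = 0 then f j else 0)"
      using r unfolding zak_corr_of_norm_zak[OF b pos norm] by (auto dest: zdvd_imp_le)
    finally show ?thesis by (simp add: h_def G_def algebra_simps)
  qed
  have "(\<Sum>i\<in>gabor_index M N. l2_inner M N f (gabor_system M N b i) * gabor_system M N b i j) =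
        (\<Sum>(k, l)\<in>{0..<int N} \<times> {0..<int M}. l2_inner M N f (gabor_system M N b (int M * k, int N * l)) *
            gabor_system M N b (int M * k, int N * l) j)"
    unfolding gabor_index_eq[OF pos]
    by (subst sum.reindex) (use pos in \<open>auto simp: inj_on_def case_prod_unfold\<close>)
  also have "\<dots> = (\<Sum>k\<in>{0..<int N}. \<Sum>l\<in>{0..<int M}.
            l2_inner M N f (gabor_system M N b (int M * k, int N * l)) *
            gabor_system M N b (int M * k, int N * l) j)"
    by (simp add: sum.cartesian_product)
  also have "\<dots> = (\<Sum>k\<in>{0..<int N}. \<Sum>l\<in>{0..<int M}. \<Sum>i\<in>{0..<int d}.
            1 / of_nat M * (G k i * unit_char (of_int (l * (j - i)) / real M)))"
  proof (intro sum.cong refl)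
    fix k l
    have *: "unit_char (- (of_int (l * i) / real M)) * unit_char (of_int (l * j) / real M) =
          unit_char (of_int (l * (j - i)) / real M)" for i
      unfolding unit_char_add[symmetric] by (simp add: algebra_simps diff_divide_distrib)
    have "f i * cnj (gabor_system M N b (int M * k, int N * l) i) *
            gabor_system M N b (int M * k, int N * l) j =
          G k i * unit_char (of_int (l * (j - i)) / real M)" for i
      unfolding gabor_system_eq[OF pos(2)] complex_cnj_mult cnj_unit_char G_def *[symmetric]
      by (simp only: mult_ac)
    thus "l2_inner M N f (gabor_system M N b (int M * k, int N * l)) *
            gabor_system M N b (int M * k, int N * l) j =
          (\<Sum>i\<in>{0..<int d}. 1 / of_nat M * (G k i * unit_char (of_int (l * (j - i)) / real M)))"
      unfolding l2_inner_def sum_distrib_left sum_distrib_right d_def by (simp only: mult.assoc)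
  qed
  also have "\<dots> = (\<Sum>k\<in>{0..<int N}. \<Sum>i\<in>{0..<int d}. \<Sum>l\<in>{0..<int M}.
            1 / of_nat M * (G k i * unit_char (of_int (l * (j - i)) / real M)))"
    by (intro sum.cong refl sum.swap)
  also have "\<dots> = (\<Sum>k\<in>{0..<int N}. \<Sum>i\<in>{0..<int d}. if int M dvd j - i then G k i else 0)"
  proof (intro sum.cong refl)
    fix k i
    show "(\<Sum>l\<in>{0..<int M}. 1 / of_nat M * (G k i * unit_char (of_int (l * (j - i)) / real M))) =
          (if int M dvd j - i then G k i else 0)"
      unfolding sum_distrib_left[symmetric] chars using pos by simp
  qed
  also have "\<dots> = (\<Sum>r\<in>{0..<int N}. \<Sum>k\<in>{0..<int N}. G k (j + int M * r))"
    unfolding residue by (rule sum.swap)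
  also have "\<dots> = (\<Sum>r\<in>{0..<int N}. if r = 0 then f j else 0)"
    using corr by (intro sum.cong refl)
  also have "\<dots> = f j" using pos by simp
  finally show ?thesis by simp
qed

lemma orthonormal_basis_of_norm_zak:
  assumes b: "b \<in> l2_space M N" and pos: "M > 0" "N > 0"
    and norm: "\<And>m n. cmod (zak M N b m n) = 1"
  shows "orthonormal_basis M N (gabor_index M N) (gabor_system M N b)"
  unfolding orthonormal_basis_def
proof (intro conjI ballI)
  fix i assume "i \<in> gabor_index M N"
  thus "gabor_system M N b i \<in> l2_space M N"
    unfolding gabor_index_eq[OF pos] using gabor_system_in_l2_space[OF b pos] by auto
next
  fix i i' assume "i \<in> gabor_index M N" "i' \<in> gabor_index M N"
  then obtain k l k' l' where
    i: "i = (int M * k, int N * l)" "k \<in> {0..<int N}" "l \<in> {0..<int M}" and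
    i': "i' = (int M * k', int N * l')" "k' \<in> {0..<int N}" "l' \<in> {0..<int M}"
    unfolding gabor_index_eq[OF pos] by (elim imageE SigmaE) auto
  have dvd_iff: "int p dvd x - y \<longleftrightarrow> x = y" if "x \<in> {0..<int p}" "y \<in> {0..<int p}" for x y p
  proof
    assume "int p dvd x - y"
    hence "x mod int p = y mod int p" by (simp add: mod_eq_dvd_iff)
    thus "x = y" using that by simp
  qed auto
  have "l2_inner M N (gabor_system M N b i) (gabor_system M N b i') =
        1 / of_nat M * (if k = k' then \<Sum>m\<in>{0..<int M}. unit_char (of_int (m * (l - l')) / real M) else 0)"
    unfolding i i' inner_gabor[OF b pos] zak_corr_of_norm_zak[OF b pos norm]
      dvd_iff[OF i'(2) i(2)] by auto
  also have "\<dots> = (if i = i' then 1 else 0)"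
    unfolding sum_roots_of_unity[OF pos(1)] dvd_iff[OF i(3) i'(3)] using pos by (auto simp: i i')
  finally show "l2_inner M N (gabor_system M N b i) (gabor_system M N b i') =
        (if i = i' then 1 else 0)" .
next
  fix f assume "f \<in> l2_space M N"
  thus "\<exists>c. \<forall>j. f j = (\<Sum>i\<in>gabor_index M N. c i * gabor_system M N b i j)"
    by (intro exI[of _ "\<lambda>i. l2_inner M N f (gabor_system M N b i)"] allI
          gabor_expansion[OF b _ pos norm])
qed

section \<open>The lower bound: vortices at every scale\<close>

definition shift_energy :: "nat \<Rightarrow> (int \<Rightarrow> complex) \<Rightarrow> int \<Rightarrow> real" where
  "shift_energy p f K = (\<Sum>x\<in>{0..<int p}. (cmod (f (x + K) - f x))\<^sup>2)"

lemma shift_energy_nonneg: "shift_energy p f K \<ge> 0"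
  by (simp add: shift_energy_def sum_nonneg)

text \<open>Over a period, differences only pick up the unimodular factor \<open>w\<close>, so their
  moduli are truly periodic and the window of summation may slide.\<close>

lemma sum_norm_diff_shift:
  assumes "p > 0" "cmod w = 1" "\<And>x. f (x + int p) = w * f x"
  shows "(\<Sum>x\<in>{0..<int p}. (cmod (f (x + t + K) - f (x + t)))\<^sup>2) = shift_energy p f K"
proof -
  define h where "h = (\<lambda>x. (cmod (f (x + K) - f x))\<^sup>2)"
  have "h (x + int p) = h x" for x
  proof -
    have "f (x + int p + K) - f (x + int p) = w * (f (x + K) - f x)"
      using assms(3)[of x] assms(3)[of "x + K"] by (simp add: algebra_simps)
    thus ?thesis by (simp add: h_def norm_mult assms(2))
  qed
  from sum_periodic_shift[of h p t, OF this assms(1)] show ?thesis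
    by (simp add: h_def shift_energy_def)
qed

text \<open>Parallelogram law for the forward and the backward difference, whose sum is a difference
  of step \<open>2 * K\<close>.\<close>

lemma sum_norm_second_diff:
  assumes "p > 0" "cmod w = 1" "\<And>x. f (x + int p) = w * f x"
  shows "(\<Sum>x\<in>{0..<int p}. (cmod (f (x + K) + f (x - K) - 2 * f x))\<^sup>2) =
         4 * shift_energy p f K - shift_energy p f (2 * K)"
proof -
  have parallelogram: "(cmod (u - v))\<^sup>2 = 2 * (cmod u)\<^sup>2 + 2 * (cmod v)\<^sup>2 - (cmod (u + v))\<^sup>2" for u v
    unfolding cmod_power2 by (simp add: power2_eq_square algebra_simps)
  have "(cmod (f (x + K) + f (x - K) - 2 * f x))\<^sup>2 =
        2 * (cmod (f (x + 0 + K) - f (x + 0)))\<^sup>2 + 2 * (cmod (f (x + - K + K) - f (x + - K)))\<^sup>2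
        - (cmod (f (x + - K + 2 * K) - f (x + - K)))\<^sup>2" for x
    using parallelogram[of "f (x + K) - f x" "f x - f (x - K)"] by (simp add: algebra_simps)
  thus ?thesis
    unfolding sum_subtractf sum.distrib sum_distrib_left[symmetric]
    by (simp only: sum_subtractf sum.distrib sum_distrib_left[symmetric]
          sum_norm_diff_shift[of p w f, OF assms])
qed

text \<open>Telescoping into unit steps and Cauchy-Schwarz; after summation over a period every unit
  step contributes equally.\<close>

lemma shift_energy_le:
  assumes "p > 0" "cmod w = 1" "\<And>x. f (x + int p) = w * f x"
  shows "shift_energy p f (int k) \<le> (real k)\<^sup>2 * shift_energy p f 1"
proof -
  have "shift_energy p f (int k) \<le>
        (\<Sum>x\<in>{0..<int p}. real k * (\<Sum>i<k. (cmod (f (x + int i + 1) - f (x + int i)))\<^sup>2))"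
    unfolding shift_energy_def
  proof (rule sum_mono)
    fix x
    have "f (x + int k) - f x = (\<Sum>i<k. f (x + int i + 1) - f (x + int i))"
      using sum_lessThan_telescope[of "\<lambda>i. f (x + int i)" k] by (simp add: add_ac)
    hence "cmod (f (x + int k) - f x) \<le> (\<Sum>i<k. cmod (f (x + int i + 1) - f (x + int i)))"
      by (simp add: norm_sum)
    hence "(cmod (f (x + int k) - f x))\<^sup>2 \<le> (\<Sum>i<k. cmod (f (x + int i + 1) - f (x + int i)))\<^sup>2"
      by (simp add: power_mono)
    also have "\<dots> \<le> real k * (\<Sum>i<k. (cmod (f (x + int i + 1) - f (x + int i)))\<^sup>2)"
      using sum_squared_le_sum_of_squares[of "\<lambda>i. cmod (f (x + int i + 1) - f (x + int i))" "{..<k}"]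
      by (simp add: mult.commute)
    finally show "(cmod (f (x + int k) - f x))\<^sup>2 \<le> \<dots>" .
  qed
  also have "\<dots> = real k * (\<Sum>i<k. \<Sum>x\<in>{0..<int p}. (cmod (f (x + int i + 1) - f (x + int i)))\<^sup>2)"
    by (subst sum.swap) (simp add: sum_distrib_left)
  also have "\<dots> = (real k)\<^sup>2 * shift_energy p f 1"
    using sum_norm_diff_shift[of p w f _ 1, OF assms] by (simp add: power2_eq_square)
  finally show ?thesis .
qed

text \<open>Project onto the direction of \<open>z\<close>: because of the jump, \<open>w\<close>
  has component at most 1/2, and \<open>v\<close> has component at most 1, so the second difference
  has component at most 1/2 + 1 - 2 = -1/2.\<close>

lemma norm_second_diff_ge:
  assumes "cmod w = 1" "cmod v = 1" "cmod z = 1" "1 \<le> cmod (w - z)"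
  shows "1 / 4 \<le> (cmod (w + v - 2 * z))\<^sup>2"
proof -
  have sq: "Re a ^ 2 + Im a ^ 2 = 1" if "cmod a = 1" for a
    using that by (simp flip: cmod_power2)
  have "1 \<le> (cmod (w - z))\<^sup>2"
    using assms(4) by (simp add: power2_eq_1_iff one_le_power)
  hence w: "Re w * Re z + Im w * Im z \<le> 1 / 2"
    using sq[OF assms(1)] sq[OF assms(3)]
    unfolding cmod_power2 by (simp add: power2_eq_square algebra_simps)
  have "0 \<le> (cmod (v - z))\<^sup>2" by simp
  hence v: "Re v * Re z + Im v * Im z \<le> 1"
    using sq[OF assms(2)] sq[OF assms(3)]
    unfolding cmod_power2 by (simp add: power2_eq_square algebra_simps)
  have "Re ((w + v - 2 * z) * cnj z) \<le> - 1 / 2"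
    using w v sq[OF assms(3)] by (simp add: power2_eq_square algebra_simps)
  hence "1 / 2 \<le> \<bar>Re ((w + v - 2 * z) * cnj z)\<bar>" by linarith
  also have "\<dots> \<le> cmod ((w + v - 2 * z) * cnj z)" by (rule abs_Re_le_cmod)
  also have "\<dots> = cmod (w + v - 2 * z)" using assms(3) by (simp add: norm_mult)
  finally have "(1 / 2)\<^sup>2 \<le> (cmod (w + v - 2 * z))\<^sup>2" by (intro power_mono) auto
  thus ?thesis by (simp add: power2_eq_square)
qed

lemma count_jumps_le:
  assumes "p > 0" "cmod w = 1" "\<And>x. f (x + int p) = w * f x" "\<And>x. cmod (f x) = 1"
  shows "(\<Sum>x\<in>{0..<int p}. of_bool (1 \<le> cmod (f (x + K) - f x))) \<le>
         4 * (4 * shift_energy p f K - shift_energy p f (2 * K))"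
  unfolding sum_norm_second_diff[of p w f, OF assms(1-3), symmetric] sum_distrib_left
proof (rule sum_mono)
  fix x
  show "of_bool (1 \<le> cmod (f (x + K) - f x)) \<le> 4 * (cmod (f (x + K) + f (x - K) - 2 * f x))\<^sup>2"
    using norm_second_diff_ge[of "f (x + K)" "f (x - K)" "f x"] assms(4)
    by (cases "1 \<le> cmod (f (x + K) - f x)") auto
qed

text \<open>An arc of length \<open>pi / 3\<close> has chord 1; this fixes the threshold at which
  \<open>count_jumps_ge\<close> regards an angle as large.\<close>

lemma norm_diff_one_ge_of_Arg:
  assumes "cmod w = 1" "pi / 3 \<le> \<bar>Arg w\<bar>"
  shows "1 \<le> cmod (w - 1)"
proof -
  have Re: "Re w = cos \<bar>Arg w\<bar>"
    using assms(1) cos_Arg[of w] by force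
  have "cos \<bar>Arg w\<bar> \<le> cos (pi / 3)"
    using assms(2) Arg_bounded[of w] by (intro cos_monotone_0_pi_le) auto
  hence "Re w \<le> 1 / 2" by (simp add: Re cos_60)
  moreover have "(cmod (w - 1))\<^sup>2 = (cmod w)\<^sup>2 + 1 - 2 * Re w"
    unfolding cmod_power2 by (simp add: power2_eq_square algebra_simps)
  ultimately have "1\<^sup>2 \<le> (cmod (w - 1))\<^sup>2" using assms(1) by simp
  thus ?thesis by (rule power2_le_imp_le) simp
qed

lemma sum_sum_periodic_shift:
  fixes F :: "int \<Rightarrow> int \<Rightarrow> 'a::comm_monoid_add"
  assumes "\<And>m n. F (m + int M) n = F m n" "\<And>m n. F m (n + int N) = F m n" "M > 0" "N > 0"
  shows "(\<Sum>m\<in>{0..<int M}. \<Sum>n\<in>{0..<int N}. F (m + s) (n + t)) =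
         (\<Sum>m\<in>{0..<int M}. \<Sum>n\<in>{0..<int N}. F m n)"
proof -
  have "(\<Sum>n\<in>{0..<int N}. F m (n + t)) = (\<Sum>n\<in>{0..<int N}. F m n)" for m
    by (rule sum_periodic_shift) fact+
  moreover have "(\<Sum>m\<in>{0..<int M}. (\<lambda>m. \<Sum>n\<in>{0..<int N}. F m n) (m + s)) =
         (\<Sum>m\<in>{0..<int M}. (\<lambda>m. \<Sum>n\<in>{0..<int N}. F m n) m)"
    by (rule sum_periodic_shift) (simp_all add: assms)
  ultimately show ?thesis by simp
qed

text \<open>Unit sections of a degree-one line bundle over a discrete torus. The lower bound
  instantiates this with Zak transforms of generators, the upper bound with the explicit
  \<open>vortex\<close>.\<close>

locale unimodular_section =
  fixes M N :: nat and Z :: "int \<Rightarrow> int \<Rightarrow> complex"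
  assumes pos: "M > 0" "N > 0"
    and quasi_periodic: "Z (m + int M) n = unit_char (of_int n / real N) * Z m n"
    and periodic: "Z m (n + int N) = Z m n"
    and unimodular: "cmod (Z m n) = 1"
begin

text \<open>In this gauge the twisted translations in the second variable become ordinary ones.\<close>

definition gauged :: "int \<Rightarrow> int \<Rightarrow> complex" where
  "gauged m n = unit_char (- of_int (m * n) / real (M * N)) * Z m n"

lemma nonzero: "Z m n \<noteq> 0"
  using unimodular[of m n] by auto

lemma norm_gauged: "cmod (gauged m n) = 1"
  by (simp add: gauged_def norm_mult unimodular)

lemma gauged_quasi_periodic:
  "gauged m (n + int N) = unit_char (- of_int m / real M) * gauged m n"
proof -
  have "- of_int (m * (n + int N)) / real (M * N) = - of_int m / real M + - of_int (m * n) / real (M * N)"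
    using pos by (simp add: field_simps)
  thus ?thesis by (simp only: gauged_def periodic unit_char_add mult.assoc)
qed

text \<open>The flux through a plaquette of size \<open>K \<times> L\<close> is \<open>2 \<pi> K L / (M N)\<close>, whereas the circulations of
  principal arguments around all plaquettes add up to zero. Hence many plaquettes carry a vortex.\<close>

lemma count_jumps_ge:
  assumes KL: "0 \<le> K" "0 \<le> L" "4 * (K * L) \<le> int (M * N)"
  shows "of_int (K * L) / 6 \<le>
    (\<Sum>m\<in>{0..<int M}. \<Sum>n\<in>{0..<int N}. of_bool (1 \<le> cmod (Z (m + K) n - Z m n)) :: real) +
    (\<Sum>m\<in>{0..<int M}. \<Sum>n\<in>{0..<int N}. of_bool (1 \<le> cmod (gauged m (n + L) - gauged m n)))"
proof -
  define d where "d = real (M * N)"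
  define u1 where "u1 = (\<lambda>m n. Z (m + K) n / Z m n)"
  define u2 where "u2 = (\<lambda>m n. gauged m (n + L) / gauged m n)"
  define A1 where "A1 = (\<lambda>m n. Arg (u1 m n))"
  define A2 where "A2 = (\<lambda>m n. Arg (u2 m n))"
  define B1 :: "int \<Rightarrow> int \<Rightarrow> real" where "B1 = (\<lambda>m n. of_bool (pi / 3 \<le> \<bar>A1 m n\<bar>))"
  define B2 :: "int \<Rightarrow> int \<Rightarrow> real" where "B2 = (\<lambda>m n. of_bool (pi / 3 \<le> \<bar>A2 m n\<bar>))"
  define flux where "flux = of_int (K * L) / d"
  define curl where "curl = (\<lambda>m n. A1 m n + A2 (m + K) n - A1 m (n + L) - A2 m n)"
  have d: "d > 0" using pos by (simp add: d_def)
  have "real_of_int (4 * (K * L)) \<le> real_of_int (int (M * N))" using KL(3) by (subst of_int_le_iff)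
  hence flux: "0 \<le> flux" "flux \<le> 1 / 4"
    using KL d by (auto simp: flux_def d_def field_simps)

  \<comment> \<open>The change of the factor \<open>unit_char (- m * L / d)\<close> under
    \<open>m + M\<close> cancels the quasi-periodicity of the quotient, so \<open>u2\<close> is
    periodic in both variables; its change under \<open>m + K\<close> is the flux.\<close>
  have u2_eq: "u2 m n = unit_char (- of_int (m * L) / d) * (Z m (n + L) / Z m n)" for m n
  proof -
    have "- of_int (m * (n + L)) / real (M * N) = - of_int (m * L) / d + - of_int (m * n) / real (M * N)"
      by (simp add: d_def algebra_simps add_divide_distrib diff_divide_distrib)
    hence "gauged m (n + L) =
           unit_char (- of_int (m * L) / d) * unit_char (- of_int (m * n) / real (M * N)) * Z m (n + L)"
      by (simp only: gauged_def unit_char_add)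
    thus ?thesis
      by (simp only: u2_def) (simp add: gauged_def)
  qed
  have norm_u: "cmod (u1 m n) = 1" "cmod (u2 m n) = 1" for m n
    by (simp_all add: u1_def u2_def norm_divide unimodular norm_gauged)
  have u1_per: "u1 (m + int M) n = u1 m n" "u1 m (n + int N) = u1 m n" for m n
  proof -
    have "Z (m + int M + K) n = unit_char (of_int n / real N) * Z (m + K) n"
      using quasi_periodic[of "m + K" n] by (simp add: add_ac)
    thus "u1 (m + int M) n = u1 m n" by (simp add: u1_def quasi_periodic)
    show "u1 m (n + int N) = u1 m n" by (simp add: u1_def periodic)
  qed
  have u2_per: "u2 (m + int M) n = u2 m n" "u2 m (n + int N) = u2 m n" for m n
  proof -
    have "Z m (n + L + int N) = Z m (n + L)" by (rule periodic)
    thus "u2 m (n + int N) = u2 m n" by (simp add: u2_eq periodic add_ac)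
    have "- of_int ((m + int M) * L) / d + of_int (n + L) / real N =
          - of_int (m * L) / d + of_int n / real N"
      using pos by (simp add: d_def field_simps)
    hence "unit_char (- of_int ((m + int M) * L) / d) * unit_char (of_int (n + L) / real N) =
           unit_char (- of_int (m * L) / d) * unit_char (of_int n / real N)"
      by (simp only: unit_char_add[symmetric])
    thus "u2 (m + int M) n = u2 m n"
      using nonzero[of m n]
      by (simp add: u2_eq quasi_periodic field_simps)
  qed
  have A_per: "A1 (m + int M) n = A1 m n" "A1 m (n + int N) = A1 m n"
              "A2 (m + int M) n = A2 m n" "A2 m (n + int N) = A2 m n" for m n
    by (simp_all add: A1_def A2_def u1_per u2_per)
  have B_per: "B1 (m + int M) n = B1 m n" "B1 m (n + int N) = B1 m n"
              "B2 (m + int M) n = B2 m n" "B2 m (n + int N) = B2 m n" for m n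
    by (simp_all add: B1_def B2_def A_per)
  have shift_A1: "(\<Sum>m\<in>{0..<int M}. \<Sum>n\<in>{0..<int N}. A1 m (n + L)) = (\<Sum>m\<in>{0..<int M}. \<Sum>n\<in>{0..<int N}. A1 m n)"
    using sum_sum_periodic_shift[of A1 M N 0 L, OF A_per(1,2) pos] by simp
  have shift_A2: "(\<Sum>m\<in>{0..<int M}. \<Sum>n\<in>{0..<int N}. A2 (m + K) n) = (\<Sum>m\<in>{0..<int M}. \<Sum>n\<in>{0..<int N}. A2 m n)"
    using sum_sum_periodic_shift[of A2 M N K 0, OF A_per(3,4) pos] by simp
  have shift_B1: "(\<Sum>m\<in>{0..<int M}. \<Sum>n\<in>{0..<int N}. B1 m (n + L)) = (\<Sum>m\<in>{0..<int M}. \<Sum>n\<in>{0..<int N}. B1 m n)"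
    using sum_sum_periodic_shift[of B1 M N 0 L, OF B_per(1,2) pos] by simp
  have shift_B2: "(\<Sum>m\<in>{0..<int M}. \<Sum>n\<in>{0..<int N}. B2 (m + K) n) = (\<Sum>m\<in>{0..<int M}. \<Sum>n\<in>{0..<int N}. B2 m n)"
    using sum_sum_periodic_shift[of B2 M N K 0, OF B_per(3,4) pos] by simp

  \<comment> \<open>If all four angles are below \<open>pi / 3\<close>, then
    \<open>curl / (2 * pi) + flux\<close> is an integer of modulus below 2/3 + 1/4, hence 0.
    Otherwise some indicator is 1 and the crude bound \<open>4 * pi + pi / 2\<close>
    suffices.\<close>
  have plaquette: "curl m n + 2 * pi * flux \<le> 6 * pi * (B1 m n + B2 (m + K) n + B1 m (n + L) + B2 m n)"
    for m n
  proof (cases "\<bar>A1 m n\<bar> < pi / 3 \<and> \<bar>A2 (m + K) n\<bar> < pi / 3 \<and> \<bar>A1 m (n + L)\<bar> < pi / 3 \<and> \<bar>A2 m n\<bar> < pi / 3")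
    case True
    have cis_A: "cis (A1 m n) = u1 m n" "cis (A2 m n) = u2 m n" for m n
    proof -
      have "u1 m n \<noteq> 0" "u2 m n \<noteq> 0" using norm_u[of m n] by auto
      thus "cis (A1 m n) = u1 m n" "cis (A2 m n) = u2 m n"
        by (simp_all add: A1_def A2_def cis_Arg sgn_eq norm_u)
    qed
    have "unit_char (curl m n / (2 * pi) + flux) = cis (curl m n) * unit_char flux"
      by (simp add: unit_char_add) (simp add: unit_char_def)
    also have "cis (curl m n) = u1 m n * u2 (m + K) n / u1 m (n + L) / u2 m n"
      by (simp add: curl_def cis_A cis_mult[symmetric] cis_divide[symmetric])
    \<comment> \<open>Around the plaquette all values of \<open>Z\<close> cancel; only the holonomy
      \<open>unit_char (- flux)\<close> will remain.\<close>
    also have "\<dots> = unit_char (- of_int ((m + K) * L) / d) / unit_char (- of_int (m * L) / d)"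
      unfolding u1_def u2_eq using nonzero by (simp add: field_simps)
    also have "unit_char (- of_int ((m + K) * L) / d) = unit_char (- of_int (m * L) / d) * unit_char (- flux)"
      unfolding unit_char_add[symmetric] flux_def
      by (simp add: ring_distribs add_divide_distrib diff_divide_distrib)
    finally have "unit_char (curl m n / (2 * pi) + flux) = unit_char (- flux) * unit_char flux"
      using norm_unit_char[of "- of_int (m * L) / d"] by auto
    hence "curl m n / (2 * pi) + flux \<in> \<int>"
      by (simp add: unit_char_eq_1_iff[symmetric] unit_char_add[symmetric])
    then obtain k where k: "curl m n / (2 * pi) + flux = of_int k" by (auto elim: Ints_cases)
    have "\<bar>curl m n\<bar> < 4 * pi / 3" using True unfolding curl_def by linarith
    hence "\<bar>curl m n / (2 * pi)\<bar> < 2 / 3" by (simp add: abs_divide field_simps)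
    hence "\<bar>real_of_int k\<bar> < 1" using k flux by linarith
    hence "k = 0" by linarith
    hence "curl m n + 2 * pi * flux = 0" using k by (simp add: field_simps)
    moreover have "0 \<le> B1 m n + B2 (m + K) n + B1 m (n + L) + B2 m n"
      by (simp add: B1_def B2_def)
    ultimately show ?thesis by simp
  next
    case False
    hence "1 \<le> B1 m n + B2 (m + K) n + B1 m (n + L) + B2 m n"
      by (auto simp: B1_def B2_def)
    hence "6 * pi * 1 \<le> 6 * pi * (B1 m n + B2 (m + K) n + B1 m (n + L) + B2 m n)"
      by (intro mult_left_mono) auto
    moreover have "curl m n \<le> 4 * pi"
      using Arg_bounded[of "u1 m n"] Arg_bounded[of "u2 (m + K) n"] Arg_bounded[of "u1 m (n + L)"]
            Arg_bounded[of "u2 m n"] unfolding curl_def A1_def A2_def by linarith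
    moreover have "2 * pi * flux \<le> 2 * pi * (1 / 4)"
      using flux by (intro mult_left_mono) auto
    ultimately show ?thesis using pi_gt_zero by linarith
  qed

  \<comment> \<open>By periodicity the circulations cancel in the sum, leaving \<open>M * N\<close>
    times \<open>2 * pi * flux\<close>; on the right each indicator sum occurs twice.\<close>
  have "12 * pi * (of_int (K * L) / 6) = (\<Sum>m\<in>{0..<int M}. \<Sum>n\<in>{0..<int N}. curl m n + 2 * pi * flux)"
    using pos by (simp add: curl_def sum.distrib sum_subtractf shift_A1 shift_A2 flux_def d_def)
  also have "\<dots> \<le> (\<Sum>m\<in>{0..<int M}. \<Sum>n\<in>{0..<int N}.
                      6 * pi * (B1 m n + B2 (m + K) n + B1 m (n + L) + B2 m n))"
    by (intro sum_mono plaquette)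
  also have "\<dots> = 12 * pi * ((\<Sum>m\<in>{0..<int M}. \<Sum>n\<in>{0..<int N}. B1 m n) +
                              (\<Sum>m\<in>{0..<int M}. \<Sum>n\<in>{0..<int N}. B2 m n))"
    unfolding sum_distrib_left[symmetric] sum.distrib shift_B1 shift_B2 by simp
  finally have "of_int (K * L) / 6 \<le> (\<Sum>m\<in>{0..<int M}. \<Sum>n\<in>{0..<int N}. B1 m n) +
                              (\<Sum>m\<in>{0..<int M}. \<Sum>n\<in>{0..<int N}. B2 m n)"
    by (rule mult_left_le_imp_le) simp
  also have "\<dots> \<le>
    (\<Sum>m\<in>{0..<int M}. \<Sum>n\<in>{0..<int N}. of_bool (1 \<le> cmod (Z (m + K) n - Z m n))) +
    (\<Sum>m\<in>{0..<int M}. \<Sum>n\<in>{0..<int N}. of_bool (1 \<le> cmod (gauged m (n + L) - gauged m n)))"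
  proof (intro add_mono sum_mono)
    fix m n
    have "cmod (u1 m n - 1) = cmod (Z (m + K) n - Z m n)"
    proof -
      have "Z (m + K) n - Z m n = (u1 m n - 1) * Z m n" using nonzero[of m n] by (simp add: u1_def field_simps)
      thus ?thesis by (simp add: norm_mult unimodular)
    qed
    thus "B1 m n \<le> of_bool (1 \<le> cmod (Z (m + K) n - Z m n))"
      using norm_diff_one_ge_of_Arg[OF norm_u(1)[of m n]] by (auto simp: B1_def A1_def)
    have "cmod (u2 m n - 1) = cmod (gauged m (n + L) - gauged m n)"
    proof -
      have "gauged m n \<noteq> 0" using norm_gauged[of m n] by auto
      hence "gauged m (n + L) - gauged m n = (u2 m n - 1) * gauged m n" by (simp add: u2_def field_simps)
      thus ?thesis by (simp add: norm_mult norm_gauged)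
    qed
    thus "B2 m n \<le> of_bool (1 \<le> cmod (gauged m (n + L) - gauged m n))"
      using norm_diff_one_ge_of_Arg[OF norm_u(2)[of m n]] by (auto simp: B2_def A2_def)
  qed
  finally show ?thesis .
qed

section \<open>Directional energies and their dyadic telescoping\<close>

definition energy1 :: "int \<Rightarrow> real" where
  "energy1 K = (\<Sum>n\<in>{0..<int N}. shift_energy M (\<lambda>m. Z m n) K)"

definition energy2 :: "int \<Rightarrow> real" where
  "energy2 L = (\<Sum>m\<in>{0..<int M}. shift_energy N (gauged m) L)"

lemma energy_nonneg: "energy1 K \<ge> 0" "energy2 L \<ge> 0"
  by (simp_all add: energy1_def energy2_def sum_nonneg shift_energy_nonneg)

lemma energy1_le: "energy1 (int k) \<le> (real k)\<^sup>2 * energy1 1"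
  unfolding energy1_def sum_distrib_left
  by (intro sum_mono shift_energy_le[where w = "unit_char (of_int n / real N)" for n])
     (auto simp: pos quasi_periodic)

lemma energy2_le: "energy2 (int k) \<le> (real k)\<^sup>2 * energy2 1"
  unfolding energy2_def sum_distrib_left
  by (intro sum_mono shift_energy_le[where w = "unit_char (- of_int m / real M)" for m])
     (auto simp: pos gauged_quasi_periodic)

text \<open>\<open>count_jumps_ge\<close> provides at least \<open>K * L / 6\<close> jumps, and by
  \<open>count_jumps_le\<close> each costs at least 1/4 in squared second differences.\<close>

lemma energy_gap_ge:
  assumes "0 \<le> K" "0 \<le> L" "4 * (K * L) \<le> int (M * N)"
  shows "of_int (K * L) / 24 \<le> 4 * (energy1 K + energy2 L) - (energy1 (2 * K) + energy2 (2 * L))"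
proof -
  have "(\<Sum>m\<in>{0..<int M}. \<Sum>n\<in>{0..<int N}. of_bool (1 \<le> cmod (Z (m + K) n - Z m n))) \<le>
        4 * (4 * energy1 K - energy1 (2 * K))"
  proof -
    have "(\<Sum>m\<in>{0..<int M}. of_bool (1 \<le> cmod (Z (m + K) n - Z m n))) \<le>
          4 * (4 * shift_energy M (\<lambda>m. Z m n) K - shift_energy M (\<lambda>m. Z m n) (2 * K))" for n
      by (rule count_jumps_le[where w = "unit_char (of_int n / real N)"])
         (auto simp: pos quasi_periodic unimodular)
    thus ?thesis
      unfolding energy1_def sum_distrib_left sum_subtractf[symmetric]
      by (subst sum.swap) (rule sum_mono)
  qed
  moreover have "(\<Sum>m\<in>{0..<int M}. \<Sum>n\<in>{0..<int N}. of_bool (1 \<le> cmod (gauged m (n + L) - gauged m n))) \<le>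
        4 * (4 * energy2 L - energy2 (2 * L))"
  proof -
    have "(\<Sum>n\<in>{0..<int N}. of_bool (1 \<le> cmod (gauged m (n + L) - gauged m n))) \<le>
          4 * (4 * shift_energy N (gauged m) L - shift_energy N (gauged m) (2 * L))" for m
      by (rule count_jumps_le[where w = "unit_char (- of_int m / real M)"])
         (auto simp: pos gauged_quasi_periodic norm_gauged)
    thus ?thesis
      unfolding energy2_def sum_distrib_left sum_subtractf[symmetric]
      by (rule sum_mono)
  qed
  ultimately have "of_int (K * L) / 6 \<le> 4 * (4 * energy1 K - energy1 (2 * K)) + 4 * (4 * energy2 L - energy2 (2 * L))"
    by (intro order_trans[OF count_jumps_ge[OF assms]] add_mono)
  thus ?thesis by argo
qed

text \<open>Divided by \<open>4 ^ s\<close>, the energy at steps \<open>2 ^ s * K\<close> and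
  \<open>2 ^ s * L\<close> drops by at least \<open>K * L / 96\<close> from each scale to the next.
  The hypothesis keeps the area of every plaquette below scale \<open>S\<close> within a quarter of
  the torus, as \<open>energy_gap_ge\<close> requires.\<close>

lemma energy_ge_scales:
  assumes "4 ^ S * (K * L) \<le> M * N"
  shows "real S * (real K * real L) / 96 \<le> (real K)\<^sup>2 * energy1 1 + (real L)\<^sup>2 * energy2 1"
proof -
  define t where "t = (\<lambda>s::nat. (energy1 (2 ^ s * int K) + energy2 (2 ^ s * int L)) / 4 ^ s)"
  have gap: "real K * real L / 96 \<le> t s - t (Suc s)" if "s < S" for s
  proof -
    have "4 ^ Suc s * (K * L) \<le> 4 ^ S * (K * L)"
      using that by (intro mult_right_mono power_increasing) auto
    hence "int (4 * (4 ^ s * (K * L))) \<le> int (M * N)"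
      using assms by (subst of_nat_le_iff) (simp only: power_Suc mult.assoc order_trans)
    hence "4 * ((2 ^ s * int K) * (2 ^ s * int L)) \<le> int (M * N)"
      by (simp add: power_mult_distrib[symmetric] mult_ac flip: power_mult_distrib)
    from energy_gap_ge[OF _ _ this]
    have "4 ^ s * (real K * real L / 24) \<le>
        4 * (energy1 (2 ^ s * int K) + energy2 (2 ^ s * int L)) -
        (energy1 (2 ^ Suc s * int K) + energy2 (2 ^ Suc s * int L))"
      by (simp add: mult_ac flip: power_mult_distrib)
    also have "\<dots> = 4 ^ s * (4 * (t s - t (Suc s)))"
      by (simp add: t_def field_simps)
    finally have "real K * real L / 24 \<le> 4 * (t s - t (Suc s))"
      by (rule mult_left_le_imp_le) simp
    thus ?thesis by simp
  qed
  have "real S * (real K * real L) / 96 = (\<Sum>s<S. real K * real L / 96)" by simp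
  also have "\<dots> \<le> (\<Sum>s<S. t s - t (Suc s))" by (rule sum_mono, rule gap) simp
  also have "\<dots> = t 0 - t S" by (rule sum_lessThan_telescope')
  also have "\<dots> \<le> t 0" using energy_nonneg by (simp add: t_def)
  also have "\<dots> \<le> (real K)\<^sup>2 * energy1 1 + (real L)\<^sup>2 * energy2 1"
    using energy1_le[of K] energy2_le[of L] by (simp add: t_def)
  finally show ?thesis .
qed

text \<open>The initial plaquette is chosen with \<open>K / M\<close> and \<open>L / N\<close> both
  comparable to \<open>1 / min M N\<close>. Then the weights \<open>K^2\<close> and
  \<open>L^2\<close> are, up to a common factor, comparable to \<open>M / N\<close> and
  \<open>N / M\<close>, and about \<open>log 2 (min M N)\<close> doublings fit.\<close>

lemma energy_ge_ln_min:
  assumes "2 \<le> M" "2 \<le> N"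
  shows "ln (real (min M N)) / 384 \<le> real M / real N * energy1 1 + real N / real M * energy2 1"
proof -
  define \<mu> where "\<mu> = min M N"
  define K where "K = max 1 (M div N)"
  define L where "L = max 1 (N div M)"
  have \<mu>: "\<mu> \<ge> 2" using assms by (simp add: \<mu>_def)
  have K: "K * \<mu> \<le> M" and L: "L * \<mu> \<le> N"
  proof -
    have "max 1 (a div b) * min a b \<le> a" if "b > 0" for a b :: nat
    proof (cases "b \<le> a")
      case True
      hence "max 1 (a div b) = a div b" using div_le_mono[OF True, of b] that by (intro max_absorb2) simp
      thus ?thesis using True by (simp add: min_absorb2)
    qed auto
    from this[of N M] this[of M N] show "K * \<mu> \<le> M" "L * \<mu> \<le> N"
      using pos by (simp_all add: K_def L_def \<mu>_def min.commute)
  qed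
  \<comment> \<open>Integer division loses at most a factor 2, which turns 1/96 into 1/192.\<close>
  have cell: "M * N \<le> 2 * (K * L * \<mu>\<^sup>2)"
  proof -
    have half: "b \<le> 2 * (max 1 (b div a) * a)" if "a \<ge> 1" for a b :: nat
    proof -
      have "b mod a \<le> a * 1" using that mod_less_divisor[of a b] by simp
      also have "\<dots> \<le> a * max 1 (b div a)" by (intro mult_left_mono) auto
      finally have rem: "b mod a \<le> a * max 1 (b div a)" .
      have "b = a * (b div a) + b mod a" by simp
      also have "\<dots> \<le> a * max 1 (b div a) + a * max 1 (b div a)"
        by (intro add_mono mult_left_mono rem) auto
      finally show ?thesis by (simp add: mult_ac)
    qed
    show ?thesis
    proof (cases "M \<le> N")
      case True
      have "M div N \<le> 1" using div_le_mono[OF True, of N] assms by simp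
      hence "K = 1" unfolding K_def by (rule max_absorb1)
      moreover have "\<mu> = M" using True by (simp add: \<mu>_def)
      ultimately
      show ?thesis using half[of M N] assms by (simp add: L_def power2_eq_square)
    next
      case False
      hence "L = 1" "\<mu> = N" using assms by (auto simp: L_def \<mu>_def)
      thus ?thesis using half[of N M] assms by (simp add: K_def power2_eq_square)
    qed
  qed
  obtain S where S: "2 ^ S \<le> \<mu>" "\<mu> < 2 ^ (S + 1)"
    using ex_power_ivl1[of 2 \<mu>] \<mu> by auto
  \<comment> \<open>This gives \<open>S + 1 <= 2 * S\<close> below, and thus the final constant 384
    = 2 * 192.\<close>
  have "S \<noteq> 0" using S \<mu> by (cases S) auto
  have "4 ^ S * (K * L) = (2 ^ S * K) * (2 ^ S * L)" by (simp add: mult_ac flip: power_mult_distrib)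
  also have "\<dots> \<le> (\<mu> * K) * (\<mu> * L)" using S by (intro mult_mono) auto
  also have "\<dots> \<le> M * N" using K L by (intro mult_mono) (auto simp: mult.commute)
  finally have "real S * (real K * real L) / 96 \<le> (real K)\<^sup>2 * energy1 1 + (real L)\<^sup>2 * energy2 1"
    by (rule energy_ge_scales)
  hence "(real \<mu>)\<^sup>2 * (real S * (real K * real L) / 96) \<le>
         (real \<mu>)\<^sup>2 * ((real K)\<^sup>2 * energy1 1 + (real L)\<^sup>2 * energy2 1)"
    by (rule mult_left_mono) simp
  also have "\<dots> = (real (K * \<mu>))\<^sup>2 * energy1 1 + (real (L * \<mu>))\<^sup>2 * energy2 1"
    by (simp add: power2_eq_square algebra_simps)
  also have "\<dots> \<le> (real M)\<^sup>2 * energy1 1 + (real N)\<^sup>2 * energy2 1"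
    using K L by (intro add_mono mult_right_mono power_mono energy_nonneg) (simp_all del: of_nat_mult)
  also have "\<dots> = real (M * N) * (real M / real N * energy1 1 + real N / real M * energy2 1)"
    using pos by (simp add: power2_eq_square field_simps)
  finally have upper: "(real \<mu>)\<^sup>2 * (real S * (real K * real L) / 96) \<le> \<dots>" .
  have "real (M * N) \<le> real (2 * (K * L * \<mu>\<^sup>2))"
    using cell by (simp only: of_nat_le_iff)
  hence "real (M * N) * (real S / 192) \<le> real (2 * (K * L * \<mu>\<^sup>2)) * (real S / 192)"
    by (rule mult_right_mono) simp
  also have "\<dots> = (real \<mu>)\<^sup>2 * (real S * (real K * real L) / 96)"
    by (simp add: field_simps)
  also note upper
  finally have "real S / 192 \<le> real M / real N * energy1 1 + real N / real M * energy2 1"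
    by (rule mult_left_le_imp_le) (use pos in simp)
  moreover have "ln (real \<mu>) \<le> 2 * real S"
  proof -
    have "real \<mu> \<le> 2 ^ (S + 1)" using S(2) by (metis less_imp_le of_nat_le_iff of_nat_numeral of_nat_power)
    hence "ln (real \<mu>) \<le> ln (2 ^ (S + 1))" using \<mu> by (subst ln_le_cancel_iff) auto
    also have "\<dots> = real (S + 1) * ln 2" by (rule ln_realpow)
    also have "\<dots> \<le> real (S + 1) * 1" using ln_2_less_1 by (intro mult_left_mono) auto
    also have "\<dots> \<le> 2 * real S" using \<open>S \<noteq> 0\<close> by simp
    finally show ?thesis .
  qed
  hence "ln (real (min M N)) / 384 \<le> real S / 192" unfolding \<mu>_def by linarith
  ultimately show ?thesis by (rule order_trans[rotated])
qed

end

text \<open>Up to a unit factor the twisted backward difference is an ordinary difference of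
  \<open>gauged\<close>, so the second energy sum is \<open>energy2 1\<close>.\<close>

lemma bl_energy_ge:
  assumes "b \<in> l2_space M N" "orthonormal_basis M N (gabor_index M N) (gabor_system M N b)"
    and "2 \<le> M" "2 \<le> N"
  shows "ln (real (min M N)) / 384 \<le> bl_energy M N b"
proof -
  have pos: "M > 0" "N > 0" using assms by auto
  interpret unimodular_section M N "zak M N b"
    using pos zak_quasi_periodic[OF assms(1)] zak_periodic norm_zak_of_orthonormal_basis[OF assms(1) pos assms(2)]
    by unfold_locales auto
  have "(\<Sum>n\<in>{0..<int N}. (cmod (unit_char (of_int m / real (M * N)) * zak M N b m (n - 1) - zak M N b m n))\<^sup>2) =
        shift_energy N (gauged m) 1" for m
  proof -
    have "(cmod (unit_char (of_int m / real (M * N)) * zak M N b m (n - 1) - zak M N b m n))\<^sup>2 =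
          (cmod (gauged m (n + - 1 + 1) - gauged m (n + - 1)))\<^sup>2" for n
    proof -
      have "- of_int (m * (n - 1)) / real (M * N) = - of_int (m * n) / real (M * N) + of_int m / real (M * N)"
        by (simp add: algebra_simps add_divide_distrib diff_divide_distrib)
      hence "gauged m n - gauged m (n - 1) = - (unit_char (- of_int (m * n) / real (M * N)) *
          (unit_char (of_int m / real (M * N)) * zak M N b m (n - 1) - zak M N b m n))"
        by (simp only: gauged_def unit_char_add ring_distribs mult.assoc) simp
      thus ?thesis by (simp add: norm_mult)
    qed
    thus ?thesis
      using sum_norm_diff_shift[of N "unit_char (- of_int m / real M)" "gauged m" "-1" 1]
        pos gauged_quasi_periodic by simp
  qed
  hence "bl_energy M N b = real M / real N * energy1 1 + real N / real M * energy2 1"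
    unfolding bl_energy_zak[OF pos] energy1_def energy2_def
    by (subst sum.swap) (simp add: shift_energy_def)
  thus ?thesis using energy_ge_ln_min[OF assms(3,4)] by simp
qed

section \<open>The upper bound: a single vortex\<close>

context unimodular_section
begin

lemma quasi_periodic_mult: "Z (m + int M * k) n = unit_char (of_int (k * n) / real N) * Z m n"
proof -
  define h where "h = (\<lambda>k. unit_char (- of_int (k * n) / real N) * Z (m + int M * k) n)"
  have "h (k + 1) = h k" for k
  proof -
    have "- of_int ((k + 1) * n) / real N + of_int n / real N = - of_int (k * n) / real N"
      by (simp add: algebra_simps add_divide_distrib diff_divide_distrib)
    hence "unit_char (- of_int ((k + 1) * n) / real N) * unit_char (of_int n / real N) =
           unit_char (- of_int (k * n) / real N)"
      by (simp only: unit_char_add[symmetric])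
    moreover have "Z (m + int M * (k + 1)) n = unit_char (of_int n / real N) * Z (m + int M * k) n"
      using quasi_periodic[of "m + int M * k" n] by (simp add: algebra_simps)
    ultimately show ?thesis by (simp only: h_def mult.assoc[symmetric])
  qed
  hence "h (0 + 1 * k) = h 0" by (rule periodic_add_mult)
  moreover have "Z (m + int M * k) n = unit_char (of_int (k * n) / real N) * h k"
    using unit_char_add[of "of_int (k * n) / real N" "- of_int (k * n) / real N"]
    by (simp add: h_def)
  moreover have "h 0 = Z m n" by (simp add: h_def)
  ultimately show ?thesis by simp
qed

text \<open>Averaging \<open>Z j\<close> gives its zeroth inverse Fourier coefficient; by
  quasi-periodicity the same average at \<open>m + M * k\<close> is the coefficient of index
  \<open>k\<close>. Thus an explicit section yields a Gabor generator.\<close>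

lemma zak_surj:
  obtains b where "b \<in> l2_space M N" "zak M N b = Z"
proof
  define b where "b = (\<lambda>j. 1 / of_nat N * (\<Sum>n\<in>{0..<int N}. Z j n))"
  have "Z (j + int (M * N)) n = Z j n" for j n
    using quasi_periodic_mult[of j "int N" n] pos by (simp add: unit_char_Ints)
  thus "b \<in> l2_space M N" by (simp add: l2_space_def b_def del: of_nat_mult)
  have fundamental: "zak M N b m n = Z m n" if n: "n \<in> {0..<int N}" for m n
  proof -
    have "of_nat N * zak M N b m n = (\<Sum>k\<in>{0..<int N}. (\<Sum>i\<in>{0..<int N}. Z m i * unit_char (of_int (- (-1) * i * k) / real N)) *
            unit_char (of_int (- 1 * n * k) / real N))"
      unfolding zak_def sum_distrib_left
    proof (rule sum.cong)
      fix k
      have "of_nat N * b (m + int M * k) = (\<Sum>i\<in>{0..<int N}. Z m i * unit_char (of_int (- (-1) * i * k) / real N))"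
        unfolding b_def quasi_periodic_mult using pos by (auto simp: mult_ac intro!: sum.cong)
      thus "of_nat N * (b (m + int M * k) * unit_char (of_int (- k * n) / real N)) =
           (\<Sum>i\<in>{0..<int N}. Z m i * unit_char (of_int (- (-1) * i * k) / real N)) *
             unit_char (of_int (- 1 * n * k) / real N)"
        by (simp add: mult.assoc[symmetric] mult.commute[of n])
    qed auto
    also have "\<dots> = of_nat N * Z m n"
      by (rule dft_inversion[OF pos(2) n]) simp
    finally show ?thesis using pos by simp
  qed
  show "zak M N b = Z"
  proof (intro ext)
    fix m n
    have "zak M N b m n = zak M N b m (n mod int N)"
      by (rule periodic_mod[symmetric]) (rule zak_periodic[OF pos(2)])
    also have "\<dots> = Z m (n mod int N)" using pos by (intro fundamental) auto
    also have "\<dots> = Z m n" by (rule periodic_mod) (rule periodic)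
    finally show "zak M N b m n = Z m n" .
  qed
qed

end

text \<open>A single vortex, located at \<open>(1, 1)\<close>: this phase vanishes on the sides \<open>x = 0\<close>, \<open>y = 0\<close> and
  \<open>y = 1\<close> of the unit square and equals \<open>y\<close> on \<open>x = 1\<close>. At the vortex itself it is \<open>0 / 0 = 0\<close>,
  but only grid points with \<open>x < 1\<close> or \<open>y < 1\<close> matter.\<close>

definition vortex_phase :: "real \<Rightarrow> real \<Rightarrow> real" where
  "vortex_phase x y = x * y * (1 - y) / ((1 - x) + (1 - y))"

text \<open>In the distances \<open>u = 1 - x\<close> and \<open>v = 1 - y\<close> the difference
  factors exactly, with \<open>y * (1 + v) <= 2\<close> and \<open>v / (u' + v) <= 1\<close>. The
  condition \<open>y < 1\<close> keeps the denominators positive.\<close>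

lemma vortex_phase_diff_x:
  assumes "0 \<le> x" "x \<le> x'" "x' \<le> 1" "0 \<le> y" "y < 1"
  shows "\<bar>vortex_phase x' y - vortex_phase x y\<bar> \<le> 2 * (x' - x) / ((1 - x) + (1 - y))"
proof -
  define u where "u = 1 - x"
  define u' where "u' = 1 - x'"
  define v where "v = 1 - y"
  have uv: "0 \<le> u'" "u' \<le> u" "u \<le> 1" "0 < v" "v \<le> 1"
    using assms by (auto simp: u_def u'_def v_def)
  have eq: "vortex_phase x' y - vortex_phase x y = (y * (1 + v)) * (v / (u' + v)) * ((x' - x) / (u + v))"
  proof -
    have "(1 - u') * y * v / (u' + v) - (1 - u) * y * v / (u + v) =
          (y * (1 + v)) * (v / (u' + v)) * ((u - u') / (u + v))"
      using uv by (simp add: divide_simps) (simp add: algebra_simps)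
    thus ?thesis by (simp add: vortex_phase_def u_def u'_def v_def)
  qed
  have "\<bar>vortex_phase x' y - vortex_phase x y\<bar> = (y * (1 + v)) * (v / (u' + v)) * ((x' - x) / (u + v))"
    unfolding eq using assms uv by (intro abs_of_nonneg mult_nonneg_nonneg divide_nonneg_nonneg) auto
  also have "\<dots> \<le> (1 * 2) * 1 * ((x' - x) / (u + v))"
    using assms uv by (intro mult_mono mult_right_mono) (auto simp: field_simps)
  finally show ?thesis
    by (simp only: u_def v_def mult_1_left mult_1_right times_divide_eq_right)
qed

text \<open>Here the factorisation leaves a factor \<open>1 - q\<close> with
  \<open>0 <= q <= 2 / (u + v)\<close>. As \<open>u + v <= 2\<close>, the term 1 is also at most
  \<open>2 / (u + v)\<close>, whence the 4.\<close>

lemma vortex_phase_diff_y: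
  assumes "0 \<le> y" "y \<le> y'" "y' \<le> 1" "0 \<le> x" "x < 1"
  shows "\<bar>vortex_phase x y' - vortex_phase x y\<bar> \<le> 4 * (y' - y) / ((1 - x) + (1 - y))"
proof -
  define u where "u = 1 - x"
  define v' where "v' = 1 - y'"
  define v where "v = 1 - y"
  have uv: "0 \<le> v'" "v' \<le> v" "v \<le> 1" "0 < u" "u \<le> 1"
    using assms by (auto simp: u_def v'_def v_def)
  have "vortex_phase x y' - vortex_phase x y =
        x * (y' - y) * (1 - ((1 + u) * (u / (u + v'))) * (1 / (u + v)))"
  proof -
    have "x * (1 - v') * v' / (u + v') - x * (1 - v) * v / (u + v) =
          x * (v - v') * (1 - ((1 + u) * (u / (u + v'))) * (1 / (u + v)))"
      using uv by (simp add: divide_simps) (simp add: algebra_simps)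
    thus ?thesis by (simp add: vortex_phase_def u_def v'_def v_def)
  qed
  also have "\<bar>\<dots>\<bar> = x * (y' - y) * \<bar>1 - ((1 + u) * (u / (u + v'))) * (1 / (u + v))\<bar>"
    using assms by (simp add: abs_mult)
  also have "\<dots> \<le> 1 * (y' - y) * (4 / (u + v))"
  proof (intro mult_mono)
    have "((1 + u) * (u / (u + v'))) * (1 / (u + v)) \<le> (2 * 1) * (1 / (u + v))"
      using uv by (intro mult_right_mono mult_mono) (auto simp: field_simps)
    moreover have "0 \<le> ((1 + u) * (u / (u + v'))) * (1 / (u + v))"
      using uv by auto
    moreover have "1 \<le> 2 / (u + v)" using uv by (simp add: field_simps)
    ultimately show "\<bar>1 - ((1 + u) * (u / (u + v'))) * (1 / (u + v))\<bar> \<le> 4 / (u + v)"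
      by simp
  qed (use assms uv in auto)
  finally show ?thesis by (simp add: u_def v_def mult.commute)
qed

text \<open>The term with \<open>m div M\<close> extends the phase from one fundamental cell to all
  integers with the required twist.\<close>

definition vortex :: "nat \<Rightarrow> nat \<Rightarrow> int \<Rightarrow> int \<Rightarrow> complex" where
  "vortex M N m n = unit_char (of_int (m div int M * n) / real N +
     vortex_phase (of_int (m mod int M) / real M) (of_int (n mod int N) / real N))"

lemma unimodular_section_vortex:
  assumes "M > 0" "N > 0"
  shows "unimodular_section M N (vortex M N)"
proof
  fix m n
  define p where "p = vortex_phase (of_int (m mod int M) / real M) (of_int (n mod int N) / real N)"
  have "of_int ((m + int M) div int M * n) / real N + p =
        of_int n / real N + (of_int (m div int M * n) / real N + p)"
    using assms by (simp add: field_simps)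
  thus "vortex M N (m + int M) n = unit_char (of_int n / real N) * vortex M N m n"
    by (simp only: vortex_def unit_char_add[symmetric] mod_add_self2 p_def)
  have "of_int (m div int M * (n + int N)) / real N + p =
        (of_int (m div int M * n) / real N + p) + of_int (m div int M)"
    using assms by (simp add: field_simps)
  thus "vortex M N m (n + int N) = vortex M N m n"
    by (simp only: vortex_def mod_add_self2 p_def[symmetric] unit_char_add_Ints Ints_of_int)
qed (use assms in \<open>simp_all add: vortex_def\<close>)

text \<open>The boundary values of \<open>vortex_phase\<close> fit the quasi-periodic extension, so
  neighbouring values can be compared through the phase alone, even across the sides
  \<open>m + 1 = M\<close> and \<open>n + 1 = N\<close>.\<close>

lemma vortex_eq:
  assumes "0 \<le> m" "m < int M" "0 \<le> n" "n < int N"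
  shows "vortex M N m n = unit_char (vortex_phase (of_int m / real M) (of_int n / real N))"
    and "vortex M N (m + 1) n = unit_char (vortex_phase (of_int (m + 1) / real M) (of_int n / real N))"
    and "vortex M N m (n + 1) = unit_char (vortex_phase (of_int m / real M) (of_int (n + 1) / real N))"
proof -
  show "vortex M N m n = unit_char (vortex_phase (of_int m / real M) (of_int n / real N))"
    using assms by (simp add: vortex_def)
  show "vortex M N (m + 1) n = unit_char (vortex_phase (of_int (m + 1) / real M) (of_int n / real N))"
  proof (cases "m + 1 = int M")
    case True
    \<comment> \<open>Since \<open>y < 1\<close>, the factor \<open>1 - y\<close> cancels at
      \<open>x = 1\<close>, and the remaining phase \<open>n / N\<close> is exactly the
      twist.\<close>
    have "real_of_int n / real N < 1" using assms by simp
    moreover have "real_of_int (m + 1) / real M = 1" unfolding True using assms by simp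
    moreover have "vortex M N (int M) n = unit_char (of_int n / real N)"
      using assms by (simp add: vortex_def vortex_phase_def)
    ultimately show ?thesis unfolding True by (simp add: vortex_phase_def unit_char_Ints)
  next
    case False
    thus ?thesis using assms by (simp add: vortex_def)
  qed
  show "vortex M N m (n + 1) = unit_char (vortex_phase (of_int m / real M) (of_int (n + 1) / real N))"
  proof (cases "n + 1 = int N")
    case True
    have "real_of_int (n + 1) / real N = 1" unfolding True using assms by simp
    thus ?thesis unfolding True using assms by (simp add: vortex_def vortex_phase_def)
  next
    case False
    thus ?thesis using assms by (simp add: vortex_def)
  qed
qed

text \<open>The reciprocal of the l1 distance from the rescaled grid point to the vortex at
  \<open>(1, 1)\<close>.\<close>

definition grid_weight :: "nat \<Rightarrow> nat \<Rightarrow> int \<Rightarrow> int \<Rightarrow> real" where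
  "grid_weight M N m n = 1 / ((1 - of_int m / real M) + (1 - of_int n / real N))"

lemma norm_vortex_diff_le:
  assumes "0 \<le> m" "m < int M" "0 \<le> n" "n < int N"
  shows "cmod (vortex M N (m + 1) n - vortex M N m n) \<le> 4 * pi / real M * grid_weight M N m n"
    and "cmod (unit_char (of_int m / real (M * N)) * vortex M N m n - vortex M N m (n + 1)) \<le>
           12 * pi / real N * grid_weight M N m n"
proof -
  define x where "x = real_of_int m / real M"
  define y where "y = real_of_int n / real N"
  define x' where "x' = real_of_int (m + 1) / real M"
  define y' where "y' = real_of_int (n + 1) / real N"
  have M: "real M > 0" and N: "real N > 0" using assms by auto
  have x: "0 \<le> x" "x < 1" "x \<le> x'" "x' \<le> 1" "x' - x = 1 / real M"
    using assms M by (auto simp: x_def x'_def divide_simps)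
  have y: "0 \<le> y" "y < 1" "y \<le> y'" "y' \<le> 1" "y' - y = 1 / real N"
    using assms N by (auto simp: y_def y'_def divide_simps)
  have w: "grid_weight M N m n = 1 / ((1 - x) + (1 - y))"
    by (simp add: grid_weight_def x_def y_def)
  have "cmod (vortex M N (m + 1) n - vortex M N m n) \<le>
        2 * pi * \<bar>vortex_phase x' y - vortex_phase x y\<bar>"
    unfolding vortex_eq[OF assms] x_def x'_def y_def by (rule norm_unit_char_diff_le)
  also have "\<dots> \<le> 2 * pi * (2 * (x' - x) / ((1 - x) + (1 - y)))"
    using x y by (intro mult_left_mono vortex_phase_diff_x) auto
  also have "\<dots> = 4 * pi / real M * grid_weight M N m n"
    unfolding w x(5) by simp
  finally show "cmod (vortex M N (m + 1) n - vortex M N m n) \<le> 4 * pi / real M * grid_weight M N m n" .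
  \<comment> \<open>The connection contributes a phase of at most \<open>1 / N\<close>, absorbed
    because the weight is at least 1/2. This accounts for 4 pi of the 12 pi; the other 8 pi come
    from \<open>vortex_phase_diff_y\<close>.\<close>
  have "1 \<le> 2 * grid_weight M N m n" unfolding w using x y by (simp add: field_simps)
  hence "2 * pi / real N * 1 \<le> 2 * pi / real N * (2 * grid_weight M N m n)"
    using N by (intro mult_left_mono) auto
  moreover have "x / real N \<le> 1 / real N" using x N by (simp add: divide_right_mono)
  hence "2 * pi * (x / real N) \<le> 2 * pi * (1 / real N)" by (intro mult_left_mono) auto
  ultimately have twist: "2 * pi * (x / real N) \<le> 4 * pi / real N * grid_weight M N m n" by simp
  have "unit_char (of_int m / real (M * N)) * vortex M N m n = unit_char (x / real N + vortex_phase x y)"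
    unfolding vortex_eq[OF assms] x_def y_def unit_char_add[symmetric] by simp
  hence "cmod (unit_char (of_int m / real (M * N)) * vortex M N m n - vortex M N m (n + 1)) =
         cmod (unit_char (x / real N + vortex_phase x y) - unit_char (vortex_phase x y'))"
    unfolding vortex_eq[OF assms] by (simp only: x_def y'_def)
  also have "\<dots> \<le> 2 * pi * \<bar>x / real N + vortex_phase x y - vortex_phase x y'\<bar>"
    by (rule norm_unit_char_diff_le)
  also have "\<dots> \<le> 2 * pi * (x / real N + \<bar>vortex_phase x y' - vortex_phase x y\<bar>)"
  proof (rule mult_left_mono)
    have "0 \<le> x / real N" using x by simp
    thus "\<bar>x / real N + vortex_phase x y - vortex_phase x y'\<bar> \<le>
          x / real N + \<bar>vortex_phase x y' - vortex_phase x y\<bar>" by arith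
  qed simp
  also have "\<dots> \<le> 2 * pi * (x / real N + 4 * (y' - y) / ((1 - x) + (1 - y)))"
    using x y by (intro mult_left_mono add_left_mono vortex_phase_diff_y) auto
  also have "\<dots> = 2 * pi * (x / real N) + 8 * pi / real N * grid_weight M N m n"
    unfolding w y(5) by (simp add: distrib_left)
  also have "\<dots> \<le> 4 * pi / real N * grid_weight M N m n + 8 * pi / real N * grid_weight M N m n"
    using twist by simp
  finally show "cmod (unit_char (of_int m / real (M * N)) * vortex M N m n - vortex M N m (n + 1)) \<le>
           12 * pi / real N * grid_weight M N m n"
    by (simp add: ring_distribs[symmetric] add_divide_distrib[symmetric])
qed

section \<open>Summing the squared inverse distance over the grid\<close>

lemma sum_int_atLeastLessThan: "(\<Sum>n\<in>{0..<int N}. f n) = (\<Sum>i<N. f (int i))"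
  by (rule sum.reindex_bij_witness[of _ int nat]) auto

lemma harm_le_ln: "n > 0 \<Longrightarrow> harm n \<le> 1 + ln (real n)"
  using decseqD[OF decseq_harm_diff_ln, of 0 "n - 1"] by (simp add: harm_def)

text \<open>Discrete comparison with the integral of an inverse square: each term is at most an
  increment of \<open>N * g\<close>, whose final value is \<open>N / u\<close>.\<close>

lemma sum_inverse_square_le:
  assumes "u > 0" "N > 0"
  shows "(\<Sum>n\<in>{0..<int N}. (1 / (u + (1 - of_int n / real N)))\<^sup>2) \<le> real N / u"
proof -
  define g where "g = (\<lambda>i. 1 / (u + (1 - real i / real N)))"
  have "(g i)\<^sup>2 \<le> real N * (g (Suc i) - g i)" if "i < N" for i
  proof -
    define w where "w = u + (1 - real (Suc i) / real N)"
    define h where "h = 1 / real N"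
    have "real (Suc i) / real N \<le> 1" using that by simp
    hence w: "w > 0" using assms unfolding w_def by linarith
    have h: "h > 0" using assms by (simp add: h_def)
    have gi: "g i = 1 / (w + h)" "g (Suc i) = 1 / w"
      by (simp_all add: g_def w_def h_def add_divide_distrib algebra_simps)
    have "w * (w + h) \<le> (w + h)\<^sup>2" using w h by (simp add: power2_eq_square algebra_simps)
    hence "(1 / (w + h))\<^sup>2 \<le> 1 / (w * (w + h))"
      unfolding power_divide power_one using w h
      by (intro divide_left_mono mult_pos_pos zero_less_power add_pos_pos) simp_all
    also have "1 / w - 1 / (w + h) = h / (w * (w + h))"
      using w h by (simp add: divide_simps)
    hence "1 / (w * (w + h)) = (1 / w - 1 / (w + h)) / h" using h by simp
    finally show ?thesis unfolding gi by (simp add: h_def mult.commute)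
  qed
  hence "(\<Sum>i<N. (g i)\<^sup>2) \<le> (\<Sum>i<N. real N * (g (Suc i) - g i))"
    by (intro sum_mono) auto
  also have "\<dots> = real N * (g N - g 0)"
    by (simp add: sum_distrib_left[symmetric] sum_lessThan_telescope)
  also have "\<dots> \<le> real N * (1 / u)"
    using assms by (intro mult_left_mono) (auto simp: g_def)
  finally show ?thesis by (simp add: sum_int_atLeastLessThan g_def)
qed

text \<open>Summing over \<open>n\<close> first leaves \<open>N / (1 - m / M)\<close>, whose sum
  over \<open>m\<close> is harmonic of length \<open>M\<close>.\<close>

lemma sum_grid_weight_le_ln:
  assumes "M > 0" "N > 0"
  shows "(\<Sum>m\<in>{0..<int M}. \<Sum>n\<in>{0..<int N}. (grid_weight M N m n)\<^sup>2) \<le>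
         real (M * N) * (1 + ln (real M))"
proof -
  have "(\<Sum>m\<in>{0..<int M}. \<Sum>n\<in>{0..<int N}. (grid_weight M N m n)\<^sup>2) \<le>
        (\<Sum>m\<in>{0..<int M}. real N / (1 - of_int m / real M))"
    unfolding grid_weight_def
    by (intro sum_mono sum_inverse_square_le) (use assms in auto)
  also have "\<dots> = (\<Sum>i<M. real (M * N) * inverse (real (M - i)))"
    unfolding sum_int_atLeastLessThan
    by (rule sum.cong) (use assms in \<open>auto simp: field_simps of_nat_diff\<close>)
  also have "\<dots> = real (M * N) * (\<Sum>i<M. inverse (real (M - i)))"
    by (rule sum_distrib_left[symmetric])
  also have "(\<Sum>i<M. inverse (real (M - i))) = harm M"
    unfolding harm_def by (rule sum.reindex_bij_witness[of _ "\<lambda>k. M - k" "\<lambda>i. M - i"]) auto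
  also have "real (M * N) * harm M \<le> real (M * N) * (1 + ln (real M))"
    using assms by (intro mult_left_mono harm_le_ln) auto
  finally show ?thesis .
qed

text \<open>The symmetry of the weight allows the harmonic sum to be taken in the shorter direction;
  this is how the minimum enters.\<close>

lemma sum_grid_weight_le:
  assumes "M > 0" "N > 0"
  shows "(\<Sum>m\<in>{0..<int M}. \<Sum>n\<in>{0..<int N}. (grid_weight M N m n)\<^sup>2) \<le>
         real (M * N) * (1 + ln (real (min M N)))"
proof (cases "M \<le> N")
  case True
  thus ?thesis using sum_grid_weight_le_ln[OF assms] by (simp add: min_def)
next
  case False
  have "(\<Sum>m\<in>{0..<int M}. \<Sum>n\<in>{0..<int N}. (grid_weight M N m n)\<^sup>2) =
        (\<Sum>n\<in>{0..<int N}. \<Sum>m\<in>{0..<int M}. (grid_weight N M n m)\<^sup>2)"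
    by (subst sum.swap) (simp add: grid_weight_def add.commute)
  thus ?thesis using sum_grid_weight_le_ln[OF assms(2,1)] False by (simp add: min_def mult.commute)
qed

lemma bl_energy_le:
  assumes "2 \<le> M" "2 \<le> N"
  obtains b where "b \<in> l2_space M N" "orthonormal_basis M N (gabor_index M N) (gabor_system M N b)"
    "bl_energy M N b \<le> 160 * pi\<^sup>2 * (1 + ln (real (min M N)))"
proof -
  have pos: "M > 0" "N > 0" using assms by auto
  interpret unimodular_section M N "vortex M N" by (rule unimodular_section_vortex[OF pos])
  obtain b where b: "b \<in> l2_space M N" "zak M N b = vortex M N" by (rule zak_surj)
  define S where "S = (\<Sum>m\<in>{0..<int M}. \<Sum>n\<in>{0..<int N}. (grid_weight M N m n)\<^sup>2)"
  have "(\<Sum>m\<in>{0..<int M}. \<Sum>n\<in>{0..<int N}. (cmod (vortex M N (m + 1) n - vortex M N m n))\<^sup>2) \<le>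
        (\<Sum>m\<in>{0..<int M}. \<Sum>n\<in>{0..<int N}. (4 * pi / real M * grid_weight M N m n)\<^sup>2)"
    by (intro sum_mono power_mono norm_vortex_diff_le) auto
  also have "\<dots> = (4 * pi / real M)\<^sup>2 * S"
    by (simp only: power_mult_distrib S_def sum_distrib_left)
  finally have 1: "(\<Sum>m\<in>{0..<int M}. \<Sum>n\<in>{0..<int N}. (cmod (vortex M N (m + 1) n - vortex M N m n))\<^sup>2) \<le> \<dots>" .
  \<comment> \<open>Passing from backward to forward differences matches
    \<open>norm_vortex_diff_le\<close>, whose base point lies in the fundamental cell.\<close>
  have shift: "(\<Sum>n\<in>{0..<int N}. (cmod (unit_char (of_int m / real (M * N)) * vortex M N m (n - 1) - vortex M N m n))\<^sup>2) =
        (\<Sum>n\<in>{0..<int N}. (cmod (unit_char (of_int m / real (M * N)) * vortex M N m n - vortex M N m (n + 1)))\<^sup>2)" for m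
  proof -
    define h where "h = (\<lambda>n. (cmod (unit_char (of_int m / real (M * N)) * vortex M N m (n - 1) - vortex M N m n))\<^sup>2)"
    have "h (n + int N) = h n" for n
      using periodic[of m "n - 1"] periodic[of m n] by (simp add: h_def algebra_simps)
    from sum_periodic_shift[of h N 1, OF this pos(2)] show ?thesis by (simp add: h_def)
  qed
  have "(\<Sum>m\<in>{0..<int M}. \<Sum>n\<in>{0..<int N}. (cmod (unit_char (of_int m / real (M * N)) * vortex M N m n - vortex M N m (n + 1)))\<^sup>2) \<le>
        (\<Sum>m\<in>{0..<int M}. \<Sum>n\<in>{0..<int N}. (12 * pi / real N * grid_weight M N m n)\<^sup>2)"
    by (intro sum_mono power_mono norm_vortex_diff_le) auto
  also have "\<dots> = (12 * pi / real N)\<^sup>2 * S"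
    by (simp only: power_mult_distrib S_def sum_distrib_left)
  finally have 2: "(\<Sum>m\<in>{0..<int M}. \<Sum>n\<in>{0..<int N}. (cmod (unit_char (of_int m / real (M * N)) * vortex M N m n - vortex M N m (n + 1)))\<^sup>2) \<le> \<dots>" .
  have "bl_energy M N b \<le> real M / real N * ((4 * pi / real M)\<^sup>2 * S) + real N / real M * ((12 * pi / real N)\<^sup>2 * S)"
    unfolding bl_energy_zak[OF pos] b(2) shift
    by (intro add_mono mult_left_mono 1 2) auto
  \<comment> \<open>The constant is 160 = 4^2 + 12^2.\<close>
  also have "\<dots> = 160 * pi\<^sup>2 / real (M * N) * S"
    using pos by (simp add: power2_eq_square field_simps)
  also have "\<dots> \<le> 160 * pi\<^sup>2 / real (M * N) * (real (M * N) * (1 + ln (real (min M N))))"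
    unfolding S_def by (intro mult_left_mono sum_grid_weight_le pos) auto
  also have "\<dots> = 160 * pi\<^sup>2 * (1 + ln (real (min M N)))" using pos by simp
  finally have "bl_energy M N b \<le> 160 * pi\<^sup>2 * (1 + ln (real (min M N)))" .
  moreover have "orthonormal_basis M N (gabor_index M N) (gabor_system M N b)"
    by (rule orthonormal_basis_of_norm_zak[OF b(1) pos]) (simp add: b(2) unimodular)
  ultimately show thesis using b(1) that by blast
qed

section \<open>The two-sided bound and divergence\<close>

theorem theorem1p9:
  shows "(\<exists>c C :: real. c > 0 \<and> C > 0 \<and>
            (\<forall>M N :: nat. M \<ge> 2 \<longrightarrow> N \<ge> 2 \<longrightarrow>
               c * ln (real (min M N)) \<le> bl_alpha M N \<and>
               bl_alpha M N \<le> C * ln (real (min M N))))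
         \<and> filterlim (\<lambda>(M, N). bl_alpha M N) at_top (filtercomap (\<lambda>(M, N). min M N) at_top)"
proof -
  define B where "B = (\<lambda>M N. {b \<in> l2_space M N. orthonormal_basis M N (gabor_index M N) (gabor_system M N b)})"
  have alpha: "bl_alpha M N = (INF b\<in>B M N. bl_energy M N b)" for M N
    by (simp add: bl_alpha_def bl_energy_def B_def)
  \<comment> \<open>The summand \<open>1 / ln 2\<close> absorbs the additive 1 of the energy bound,
    since \<open>ln (min M N) >= ln 2\<close>.\<close>
  define C where "C = 160 * pi\<^sup>2 * (1 / ln 2 + 1)"
  have C: "C > 0" by (simp add: C_def add_pos_pos)
  have bounds: "1 / 384 * ln (real (min M N)) \<le> bl_alpha M N \<and> bl_alpha M N \<le> C * ln (real (min M N))"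
    if MN: "M \<ge> 2" "N \<ge> 2" for M N
  proof -
    obtain b where b: "b \<in> B M N" "bl_energy M N b \<le> 160 * pi\<^sup>2 * (1 + ln (real (min M N)))"
      using bl_energy_le[OF MN] unfolding B_def by blast
    \<comment> \<open>This also supplies the boundedness from below needed for
      \<open>cINF_lower\<close>.\<close>
    have lower: "1 / 384 * ln (real (min M N)) \<le> bl_energy M N b" if "b \<in> B M N" for b
      using bl_energy_ge[of b M N] that MN by (simp add: B_def)
    have "1 / 384 * ln (real (min M N)) \<le> bl_alpha M N"
      unfolding alpha using b(1) lower by (intro cINF_greatest) auto
    moreover have "bl_alpha M N \<le> C * ln (real (min M N))"
    proof -
      have "bl_alpha M N \<le> bl_energy M N b"
        unfolding alpha using lower by (intro cINF_lower b(1) bdd_belowI2)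
      also note b(2)
      also have "1 + ln (real (min M N)) \<le> (1 / ln 2 + 1) * ln (real (min M N))"
      proof -
        have "ln 2 \<le> ln (real (min M N))" using MN by (subst ln_le_cancel_iff) auto
        thus ?thesis by (simp add: field_simps)
      qed
      hence "160 * pi\<^sup>2 * (1 + ln (real (min M N))) \<le> C * ln (real (min M N))"
        unfolding C_def mult.assoc by (intro mult_left_mono) auto
      finally show ?thesis by simp
    qed
    ultimately show ?thesis ..
  qed
  \<comment> \<open>Convergence along this \<open>filtercomap\<close> means that
    \<open>min M N\<close> tends to infinity, with no restriction on the ratio of \<open>M\<close>
    and \<open>N\<close>.\<close>
  have "filterlim (\<lambda>p. 1 / 384 * ln (real ((\<lambda>(M, N). min M N) p))) at_top
          (filtercomap (\<lambda>(M, N). min M N) at_top)"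
  proof (rule filterlim_compose[OF _ filterlim_filtercomap])
    show "filterlim (\<lambda>n. 1 / 384 * ln (real n)) at_top at_top"
      by (intro filterlim_tendsto_pos_mult_at_top[OF tendsto_const]
            filterlim_compose[OF ln_at_top filterlim_real_sequentially]) auto
  qed
  moreover have "eventually (\<lambda>p. 1 / 384 * ln (real ((\<lambda>(M, N). min M N) p)) \<le> (\<lambda>(M, N). bl_alpha M N) p)
          (filtercomap (\<lambda>(M, N). min M N) at_top)"
    unfolding eventually_filtercomap
    by (rule exI[of _ "\<lambda>n. n \<ge> 2"]) (use bounds eventually_ge_at_top in auto)
  ultimately have "filterlim (\<lambda>(M, N). bl_alpha M N) at_top (filtercomap (\<lambda>(M, N). min M N) at_top)"
    by (rule filterlim_at_top_mono)
  moreover have "\<exists>c C :: real. c > 0 \<and> C > 0 \<and>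
            (\<forall>M N :: nat. M \<ge> 2 \<longrightarrow> N \<ge> 2 \<longrightarrow>
               c * ln (real (min M N)) \<le> bl_alpha M N \<and>
               bl_alpha M N \<le> C * ln (real (min M N)))"
    using bounds C by (intro exI[of _ "1 / 384"] exI[of _ C]) auto
  ultimately show ?thesis by simp
qed

end
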